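(* Let $F_q$ be the finite field with $q$ elements, where $q$ is not a power of $2$, let $n\geq 1$, and let $F$ be an algebraically closed field of characteristic different from $2$. Then $(O_{n+1}(F_{q}),O_{n}(F_{q}))$ is a Gelfand pair over $F$; that is, for every irreducible representation $\pi$ of $O_{n+1}(F_q)$ over $F$, $\dim \pi^{O_n(F_q)}\leq 1$.
   Context: $O_m(F_q)=\{g\in GL_m(F_q): g^{t}g=I_m\}$ is the orthogonal group of the standard bilinear form $\langle x,y\rangle=\sum_i x_iy_i$ on $F_q^m$. $O_n(F_q)$ is viewed as a subgroup of $O_{n+1}(F_q)$ via $B\mapsto\begin{pmatrix}B&0\\0&1\end{pmatrix}$. A pair $(G,H)$ of a finite group and its subgroup is a Gelfand pair over $F$ if for every irreducible representation $\pi$ of $G$ over $F$ the space $\pi^{H}$ of $H$-invariant vectors has dimension at most $1$. *)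

theory Defs
  imports
    "HOL-Computational_Algebra.Polynomial"
    "Jordan_Normal_Form.Matrix"
begin

section \<open>Orthogonal groups\<close>

definition GL_group :: "'a::field itself \<Rightarrow> nat \<Rightarrow> 'a mat monoid" where
  "GL_group ty m = units_of (ring_mat ty m ())"

definition orthogonal_group :: "'a::field itself \<Rightarrow> nat \<Rightarrow> 'a mat monoid" where
  "orthogonal_group ty m =
     (GL_group ty m)\<lparr>carrier := {g \<in> carrier (GL_group ty m). transpose_mat g * g = 1\<^sub>m m}\<rparr>"

definition corner_embedding :: "nat \<Rightarrow> 'a::field mat \<Rightarrow> 'a mat" where
  "corner_embedding n B = four_block_mat B (0\<^sub>m n 1) (0\<^sub>m 1 n) (1\<^sub>m 1)"

section \<open>Representations and Gelfand pairs\<close>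

text \<open>A representation acts on the vector space formed by the whole type \<open>'v\<close> with
  scalar multiplication \<open>scale\<close>; the values of \<open>\<pi>\<close> outside \<open>carrier G\<close> are irrelevant.\<close>

definition representation ::
  "('g, 'm) monoid_scheme \<Rightarrow> ('k::field \<Rightarrow> 'v::ab_group_add \<Rightarrow> 'v) \<Rightarrow> ('g \<Rightarrow> 'v \<Rightarrow> 'v) \<Rightarrow> bool"
where
  "representation G scale \<pi> \<longleftrightarrow>
     vector_space scale \<and>
     (\<forall>g \<in> carrier G. Vector_Spaces.linear scale scale (\<pi> g)) \<and>
     \<pi> \<one>\<^bsub>G\<^esub> = id \<and>
     (\<forall>g \<in> carrier G. \<forall>h \<in> carrier G. \<pi> (g \<otimes>\<^bsub>G\<^esub> h) = \<pi> g \<circ> \<pi> h)"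

definition irreducible_representation ::
  "('g, 'm) monoid_scheme \<Rightarrow> ('k::field \<Rightarrow> 'v::ab_group_add \<Rightarrow> 'v) \<Rightarrow> ('g \<Rightarrow> 'v \<Rightarrow> 'v) \<Rightarrow> bool"
where
  "irreducible_representation G scale \<pi> \<longleftrightarrow>
     representation G scale \<pi> \<and>
     (UNIV :: 'v set) \<noteq> {0} \<and>
     (\<forall>W. module.subspace scale W \<and> (\<forall>g \<in> carrier G. \<pi> g ` W \<subseteq> W) \<longrightarrow> W = {0} \<or> W = UNIV)"

definition invariants :: "'g set \<Rightarrow> ('g \<Rightarrow> 'v \<Rightarrow> 'v) \<Rightarrow> 'v set" where
  "invariants H \<pi> = {v. \<forall>h \<in> H. \<pi> h v = v}"

text \<open>The library's \<open>dim\<close> is \<open>0\<close> on infinite-dimensional spaces, so a dimension bound also has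
  to say that the space is finitely spanned.\<close>

definition dim_at_most ::
  "('k::field \<Rightarrow> 'v::ab_group_add \<Rightarrow> 'v) \<Rightarrow> 'v set \<Rightarrow> nat \<Rightarrow> bool"
where
  "dim_at_most scale W d \<longleftrightarrow>
     (\<exists>B. finite B \<and> module.span scale B = W) \<and> vector_space.dim scale W \<le> d"

text \<open>HOL cannot quantify over types inside a formula, so the type \<open>'v\<close> carrying the
  representations is a parameter; ``Gelfand pair over \<open>'k\<close>'' is the statement with \<open>'v\<close> a
  free type variable.\<close>

definition gelfand_pair ::
  "'k::field itself \<Rightarrow> 'v::ab_group_add itself \<Rightarrow> ('g, 'm) monoid_scheme \<Rightarrow> 'g set \<Rightarrow> bool"
where
  "gelfand_pair _ _ G H \<longleftrightarrow>
     group G \<and> finite (carrier G) \<and> subgroup H G \<and>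
     (\<forall>(scale :: 'k \<Rightarrow> 'v \<Rightarrow> 'v) \<pi>.
        irreducible_representation G scale \<pi> \<longrightarrow> dim_at_most scale (invariants H \<pi>) 1)"

end

theory Submission
  imports
    Defs
    "HOL-Library.Function_Algebras"
    "Jordan_Normal_Form.Determinant"
begin

text \<open>Let \<open>G = O\<^bsub>n+1\<^esub>(F\<^sub>q)\<close>, \<open>H = O\<^sub>n(F\<^sub>q)\<close> and let \<open>\<sigma>\<close> be the anti-involution of the group algebra that
  inverts group elements. Since \<open>H\<close> is the stabilizer of a unit vector, Witt's theorem shows that \<open>\<sigma>\<close>
  preserves all double cosets of \<open>H\<close>. If \<open>\<Lambda>\<close> is a nonzero \<open>H\<close>-invariant functional on \<open>\<pi>\<close>, then
  \<open>\<Lambda> (a v) = \<Lambda> (\<sigma>(a) v)\<close> for all \<open>H\<close>-invariant \<open>v\<close>, so all nonzero \<open>H\<close>-invariant vectors have the same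
  annihilator and are proportional by Burnside's theorem.

  In the modular case it is not automatic that such a \<open>\<Lambda>\<close> exists once \<open>\<pi>\<close> has an \<open>H\<close>-invariant
  vector. It follows from the theorem of Wonenburger that every isometry \<open>g\<close> is conjugate to its inverse:
  the trace of \<open>\<pi>\<close> is then \<open>\<sigma>\<close>-invariant, hence so is the kernel of \<open>\<pi>\<close>, and \<open>\<sigma>\<close> carries a rank one
  operator whose image is a line of \<open>H\<close>-invariant vectors to an operator that factors through \<open>\<Lambda>\<close>.

  Wonenburger's theorem is proved by splitting off \<open>g\<close>-stable orthogonal summands until none
  remain. Such a space is generated over \<open>F[g, g\<^sup>-\<^sup>1]\<close> by one vector \<open>x\<close>, or by two vectors
  \<open>x\<close>, \<open>y\<close> with \<open>F[g + g\<^sup>-\<^sup>1] x\<close> orthogonal to \<open>y\<close>, and the map that fixes \<open>x\<close>, negates \<open>y\<close>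
  and turns \<open>g\<close> into \<open>g\<^sup>-\<^sup>1\<close> is an isometry.\<close>

section \<open>Operators given by polynomials\<close>

locale vector_endomorphism = vector_space scale
  for scale :: "'a::field \<Rightarrow> 'v::ab_group_add \<Rightarrow> 'v" +
  fixes f :: "'v \<Rightarrow> 'v"
  assumes f_add: "f (u + v) = f u + f v"
    and f_scale: "f (scale a u) = scale a (f u)"
begin

lemma f_zero [simp]: "f 0 = 0"
  using f_add[of 0 0] by simp

text \<open>Horner evaluation of the operator p(f) at \<open>v\<close>.\<close>

definition poly_act :: "'a poly \<Rightarrow> 'v \<Rightarrow> 'v" where
  "poly_act p v = fold_coeffs (\<lambda>a h v. scale a v + f (h v)) p (\<lambda>_. 0) v"

lemma poly_act_0 [simp]: "poly_act 0 v = 0"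
  by (simp add: poly_act_def)

lemma poly_act_pCons [simp]: "poly_act (pCons a p) v = scale a v + f (poly_act p v)"
proof (cases "p = 0 \<and> a = 0")
  case False
  then consider "a \<noteq> 0" | "p \<noteq> 0" by auto
  then show ?thesis
    by cases (simp_all add: poly_act_def )
qed simp

lemma poly_act_right_add: "poly_act p (u + v) = poly_act p u + poly_act p v"
  by (induction p) (auto simp: scale_right_distrib f_add algebra_simps)

lemma poly_act_add: "poly_act (p + q) v = poly_act p v + poly_act q v"
proof (induction p arbitrary: q)
  case (pCons a p)
  show ?case
  proof (cases q)
    case (pCons b q')
    then show ?thesis
      by (simp add: pCons.IH scale_left_distrib f_add algebra_simps)
  qed
qed simp

lemma poly_act_smult: "poly_act (Polynomial.smult a p) v = scale a (poly_act p v)"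
  by (induction p) (auto simp: scale_right_distrib f_scale)

lemma poly_act_mult: "poly_act (p * q) v = poly_act p (poly_act q v)"
  by (induction p) (auto simp: poly_act_add poly_act_smult)

text \<open>Viewing the space as a module over the polynomial ring makes the library rules for
  differences and sums available. The rule \<open>act.scale_scale\<close> is removed from the
  simpset below because it rewrites against \<open>poly_act_mult\<close>.\<close>

lemma module_poly_act: "Modules.module poly_act"
  by unfold_locales
    (auto simp: poly_act_add poly_act_mult poly_act_right_add one_pCons)

sublocale act: Modules.module poly_act
  by (rule module_poly_act)

declare act.scale_scale [simp del]

lemma f_sum: "f (sum h A) = (\<Sum>x\<in>A. f (h x))"
  by (induction A rule: infinite_finite_induct) (auto simp: f_add)

lemma poly_act_f: "poly_act p (f v) = f (poly_act p v)"
  by (induction p) (auto simp: f_add f_scale)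

lemma poly_act_commute:
  assumes "\<And>u v. h (u + v) = h u + h v" "\<And>a u. h (scale a u) = scale a (h u)"
    and "\<And>u. h (f u) = f (h u)"
  shows "poly_act p (h v) = h (poly_act p v)"
proof -
  have "h 0 = 0" using assms(1)[of 0 0] by simp
  then show ?thesis by (induction p) (auto simp: assms)
qed

lemma poly_act_scale: "poly_act p (scale a v) = scale a (poly_act p v)"
  by (rule poly_act_commute) (auto simp: scale_right_distrib f_scale scale_left_commute)

lemma poly_act_monom: "poly_act (monom a n) v = scale a ((f ^^ n) v)"
  by (induction n) (auto simp: monom_Suc f_scale monom_0)

lemma poly_act_in_subspace:
  assumes "subspace U" "\<And>u. u \<in> U \<Longrightarrow> f u \<in> U" "v \<in> U"
  shows "poly_act p v \<in> U"
  by (induction p) (auto intro!: subspace_0 subspace_add subspace_scale assms)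

end

section \<open>Isometries are conjugate to their inverses\<close>

locale bilinear_space = vector_space scale
  for scale :: "'a::field \<Rightarrow> 'v::ab_group_add \<Rightarrow> 'v" +
  fixes B :: "'v \<Rightarrow> 'v \<Rightarrow> 'a"
  assumes two: "(2::'a) \<noteq> 0"
    and B_add: "B (u + v) w = B u w + B v w"
    and B_scale: "B (scale a u) w = a * B u w"
    and B_sym: "B u v = B v u"
begin

lemma B_add_right: "B w (u + v) = B w u + B w v"
  using B_add B_sym by metis

lemma B_scale_right: "B w (scale a u) = a * B w u"
  using B_scale B_sym by metis

lemma B_0 [simp]: "B 0 v = 0" "B v 0 = 0"
  using B_scale[of 0 0 v] B_sym[of v 0] by auto

lemma B_minus: "B (- u) w = - B u w" "B w (- u) = - B w u"
  using B_add[of u "- u" w] B_add_right[of w u "- u"] by (auto simp: eq_neg_iff_add_eq_0 add.commute)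

lemma B_diff: "B (u - v) w = B u w - B v w" "B w (u - v) = B w u - B w v"
  by (simp_all only: diff_conv_add_uminus B_add B_add_right B_minus)

lemmas B_simps = B_add B_add_right B_scale B_scale_right B_minus B_diff

lemma eq_minus_imp_0: "(x::'a) = - x \<Longrightarrow> x = 0"
proof -
  assume "x = - x"
  then have "2 * x = 0" by (metis add.right_inverse mult_2)
  then show "x = 0" using two by simp
qed

definition nondegenerate_on :: "'v set \<Rightarrow> bool" where
  "nondegenerate_on U \<longleftrightarrow> (\<forall>u\<in>U. (\<forall>v\<in>U. B u v = 0) \<longrightarrow> u = 0)"

text \<open>Induction on the number of elements, which stands in for the dimension. An anisotropic
  vector of \<open>W\<close> is split off; if there is none, polarization makes the form vanish on
  \<open>W\<close>, so \<open>W\<close> is zero.\<close>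

lemma orthogonal_projection:
  assumes "finite W" "subspace W" "nondegenerate_on W"
  shows "\<exists>w\<in>W. \<forall>v\<in>W. B (u - w) v = 0"
  using assms
proof (induction "card W" arbitrary: W u rule: less_induct)
  case less
  show ?case
  proof (cases "\<forall>w\<in>W. B w w = 0")
    case True
    have "B u v = 0" if uv: "u \<in> W" "v \<in> W" for u v
    proof -
      have "u + v \<in> W" using uv less.prems(2) by (simp add: subspace_add)
      then have "B (u + v) (u + v) = 0" using True by blast
      then have "B u v + B u v = 0"
        using True uv by (simp add: B_simps B_sym[of v u])
      then show ?thesis by (metis eq_minus_imp_0 eq_neg_iff_add_eq_0)
    qed
    then have "W \<subseteq> {0}" using less.prems(3) by (auto simp: nondegenerate_on_def)
    moreover have "0 \<in> W" using less.prems(2) by (rule subspace_0)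
    ultimately show ?thesis by (intro bexI[of _ 0]) auto
  next
    case False
    then obtain w where w: "w \<in> W" "B w w \<noteq> 0" by blast
    define W' where "W' = {v \<in> W. B v w = 0}"
    have sub: "subspace W'"
      using less.prems(2) by (auto simp: W'_def subspace_def B_simps)
    have proj: "v - scale (B v w / B w w) w \<in> W'" if "v \<in> W" for v
      using that w less.prems(2) by (auto simp: W'_def B_simps subspace_diff subspace_scale)
    have nd: "nondegenerate_on W'"
      unfolding nondegenerate_on_def
    proof safe
      fix u assume u: "u \<in> W'" "\<forall>v\<in>W'. B u v = 0"
      have "B u v = 0" if "v \<in> W" for v
      proof -
        have "B u (v - scale (B v w / B w w) w) = 0" using u(2) proj[OF that] by blast
        then show ?thesis using u(1) by (simp add: B_simps W'_def)
      qed
      then show "u = 0" using less.prems(3) u(1) by (auto simp: nondegenerate_on_def W'_def)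
    qed
    have "W' \<subset> W" using w by (auto simp: W'_def)
    then have "card W' < card W" using less.prems(1) by (rule psubset_card_mono[rotated])
    moreover have "finite W'" using less.prems(1) by (simp add: W'_def)
    ultimately obtain w' where w': "w' \<in> W'" "\<forall>v\<in>W'. B (u - scale (B u w / B w w) w - w') v = 0"
      using less.hyps[of W' "u - scale (B u w / B w w) w"] sub nd by blast
    let ?p = "w' + scale (B u w / B w w) w"
    have 1: "B (u - ?p) w = 0"
      using w w'(1) by (simp add: B_simps W'_def)
    have "B (u - ?p) v = 0" if "v \<in> W" for v
    proof -
      have "B (u - ?p) (v - scale (B v w / B w w) w) = 0"
        using w'(2) proj[OF that] by (metis diff_diff_eq add.commute)
      then show ?thesis using 1 by (simp add: B_simps)
    qed
    moreover have "?p \<in> W"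
      using w w' less.prems(2) by (auto simp: W'_def subspace_add subspace_scale)
    ultimately show ?thesis by blast
  qed
qed

text \<open>The map is constrained only on \<open>U\<close>. On a finite nondegenerate
  \<open>U\<close>, preserving \<open>B\<close> already forces it to be a bijection of
  \<open>U\<close>.\<close>

definition isometry_on :: "'v set \<Rightarrow> ('v \<Rightarrow> 'v) \<Rightarrow> bool" where
  "isometry_on U h \<longleftrightarrow> (\<forall>u\<in>U. h u \<in> U) \<and> (\<forall>u\<in>U. \<forall>v\<in>U. h (u + v) = h u + h v)
     \<and> (\<forall>a. \<forall>u\<in>U. h (scale a u) = scale a (h u)) \<and> (\<forall>u\<in>U. \<forall>v\<in>U. B (h u) (h v) = B u v)"

end

section \<open>An isometry and the polynomials in \<open>c = g + g'\<close>\<close>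

locale isometry = bilinear_space scale B
  for scale :: "'a::field \<Rightarrow> 'v::ab_group_add \<Rightarrow> 'v" and B +
  fixes g g' :: "'v \<Rightarrow> 'v"
  assumes g_add: "g (u + v) = g u + g v"
    and g_scale: "g (scale a u) = scale a (g u)"
    and gg' [simp]: "g (g' u) = u"
    and g'g [simp]: "g' (g u) = u"
    and B_g: "B (g u) (g v) = B u v"
begin

lemma g'_add: "g' (u + v) = g' u + g' v"
  by (metis g_add gg' g'g)

lemma g'_scale: "g' (scale a u) = scale a (g' u)"
  by (metis g_scale gg' g'g)

lemma g_0 [simp]: "g 0 = 0" "g' 0 = 0"
  using g_scale[of 0 0] g'_scale[of 0 0] by simp_all

lemma g_minus: "g (- u) = - g u" "g' (- u) = - g' u"
  using g_scale[of "-1" u] g'_scale[of "-1" u] by simp_all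

lemma g_diff: "g (u - v) = g u - g v" "g' (u - v) = g' u - g' v"
  by (simp_all only: diff_conv_add_uminus g_add g'_add g_minus)

lemma B_g_left: "B (g u) v = B u (g' v)"
  using B_g[of u "g' v"] by simp

lemma B_g'_left: "B (g' u) v = B u (g v)"
  using B_g[of "g' u" v] by simp

text \<open>Twice the self-adjoint and the skew-adjoint part of \<open>g\<close>.\<close>

definition c where "c u = g u + g' u"
definition d where "d u = g u - g' u"

lemma c_add: "c (u + v) = c u + c v" and c_scale: "c (scale a u) = scale a (c u)"
  by (simp_all add: c_def g_add g'_add g_scale g'_scale scale_right_distrib)

sublocale vector_endomorphism scale c
  by unfold_locales (auto simp: c_add c_scale)

lemma d_add: "d (u + v) = d u + d v" and d_scale: "d (scale a u) = scale a (d u)"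
  by (simp_all add: d_def g_add g'_add g_scale g'_scale scale_right_diff_distrib algebra_simps(1-3))

lemma d_0 [simp]: "d 0 = 0"
  using d_add[of 0 0] by simp

lemma B_c: "B (c u) v = B u (c v)"
  by (simp add: c_def B_simps B_g_left B_g'_left)

lemma B_d: "B (d u) v = - B u (d v)"
  by (simp add: d_def B_simps B_g_left B_g'_left)

lemma B_act: "B (poly_act p u) v = B u (poly_act p v)"
  by (induction p arbitrary: v) (auto simp: B_simps B_c poly_act_f)

lemma act_d: "poly_act p (d u) = d (poly_act p u)"
  by (rule poly_act_commute) (simp_all add: d_add d_scale, simp add: d_def c_def g_add g'_add g_diff)

definition D :: "'a poly" where "D = [:-4, 0, 1:]"

text \<open>The identity (g - g')^2 = (g + g')^2 - 4, with \<open>D\<close> the polynomial X^2 - 4.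
  It expresses a product of two factors \<open>d\<close> by \<open>c\<close> alone.\<close>

lemma dd: "d (d u) = poly_act D u"
proof -
  have "scale 2 u = u + u"
    using scale_left_distrib[of 1 1 u] by simp
  then have "scale (-4) u = - (u + u + (u + u))"
    using scale_left_distrib[of 2 2 u] by simp
  moreover have "poly_act D u = scale (-4) u + c (c u)"
    by (simp add: D_def c_def g_add g'_add)
  moreover have "c (c u) = g (g u) + u + (u + g' (g' u))" "d (d u) = g (g u) - u - (u - g' (g' u))"
    by (simp_all add: c_def d_def g_add g'_add g_diff)
  ultimately show ?thesis by simp
qed

text \<open>The operator p(c) d is skew-adjoint, and a skew-adjoint operator has zero quadratic form
  when 2 is invertible.\<close>

lemma B_act_d_self: "B (poly_act p (d x)) x = 0"
proof -
  have "B (poly_act p (d x)) x = - B (poly_act p (d x)) x"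
    by (metis B_act B_d B_sym act_d)
  then show ?thesis by (rule eq_minus_imp_0)
qed

text \<open>Closure under \<open>c\<close> and \<open>d\<close> thus gives closure of a subspace
  under \<open>g\<close> and \<open>g'\<close>.\<close>

lemma g_eq: "g u = scale (1/2) (c u + d u)" "g' u = scale (1/2) (c u - d u)"
proof -
  have "scale (1/2) (u + u) = u" for u
    using scale_left_distrib[of "1/2" "1/2" u] two by (simp add: scale_right_distrib)
  then show "g u = scale (1/2) (c u + d u)" "g' u = scale (1/2) (c u - d u)"
    by (simp_all add: c_def d_def)
qed

definition stable :: "'v set \<Rightarrow> bool" where
  "stable U \<longleftrightarrow> subspace U \<and> (\<forall>u\<in>U. g u \<in> U \<and> g' u \<in> U)"

lemma stable_act: "stable U \<Longrightarrow> u \<in> U \<Longrightarrow> poly_act p u \<in> U"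
  by (rule poly_act_in_subspace) (auto simp: stable_def c_def subspace_add)

lemma stable_d: "stable U \<Longrightarrow> u \<in> U \<Longrightarrow> d u \<in> U"
  by (auto simp: stable_def d_def subspace_diff)

definition reversible :: "'v set \<Rightarrow> bool" where
  "reversible U \<longleftrightarrow> (\<exists>h. isometry_on U h \<and> (\<forall>u\<in>U. h (g u) = g' (h u)))"

text \<open>\<open>U\<close> is the orthogonal sum of \<open>W\<close> and its complement in
  \<open>U\<close>, so the two reversing isometries are glued along the orthogonal projection
  \<open>P\<close>.\<close>

lemma reversible_orthogonal_sum:
  assumes "stable U" "stable W" "W \<subseteq> U" "finite W" "nondegenerate_on W"
    and "reversible W" "reversible {u\<in>U. \<forall>w\<in>W. B u w = 0}"
  shows "reversible U"
proof -
  let ?W' = "{u\<in>U. \<forall>w\<in>W. B u w = 0}"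
  obtain h1 where h1: "isometry_on W h1" "\<And>u. u \<in> W \<Longrightarrow> h1 (g u) = g' (h1 u)"
    using assms(6) by (auto simp: reversible_def)
  obtain h2 where h2: "isometry_on ?W' h2" "\<And>u. u \<in> ?W' \<Longrightarrow> h2 (g u) = g' (h2 u)"
    using assms(7) unfolding reversible_def by blast
  have sW: "subspace W" and sU: "subspace U" using assms(1,2) by (auto simp: stable_def)
  define P where "P u = (SOME w. w \<in> W \<and> (\<forall>v\<in>W. B (u - w) v = 0))" for u
  have P: "P u \<in> W" "v \<in> W \<Longrightarrow> B (u - P u) v = 0" for u v
    using someI_ex[of "\<lambda>w. w \<in> W \<and> (\<forall>v\<in>W. B (u - w) v = 0)"]
      orthogonal_projection[OF assms(4) sW assms(5), of u] by (auto simp: P_def)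
  \<comment> \<open>Nondegeneracy of \<open>W\<close> makes the chosen projection unique, which
    yields its linearity and that it commutes with \<open>g\<close>.\<close>
  have P_eq: "P u = w" if "w \<in> W" "\<And>v. v \<in> W \<Longrightarrow> B (u - w) v = 0" for u w
  proof -
    have "P u - w \<in> W" using P(1) that(1) sW by (simp add: subspace_diff)
    moreover have "B (P u - w) v = 0" if "v \<in> W" for v
      using P(2)[OF that, of u] \<open>\<And>v. v \<in> W \<Longrightarrow> B (u - w) v = 0\<close>[OF that] by (simp add: B_simps)
    ultimately have "P u - w = 0" using assms(5) by (auto simp: nondegenerate_on_def)
    then show ?thesis by simp
  qed
  have P_add: "P (u + v) = P u + P v" for u v
  proof (rule P_eq)
    show "B (u + v - (P u + P v)) w = 0" if "w \<in> W" for w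
      using P(2)[OF that, of u] P(2)[OF that, of v] by (simp add: B_simps)
  qed (use P(1) sW subspace_add in auto)
  have P_scale: "P (scale a u) = scale a (P u)" for a u
  proof (rule P_eq)
    show "B (scale a u - scale a (P u)) w = 0" if "w \<in> W" for w
      using P(2)[OF that, of u] by (simp add: B_simps)
  qed (use P(1) sW subspace_scale in auto)
  have P_g: "P (g u) = g (P u)" for u
  proof (rule P_eq)
    show "B (g u - g (P u)) w = 0" if "w \<in> W" for w
      using P(2)[of "g' w" u] that assms(2) by (simp add: B_simps B_g_left stable_def)
  qed (use P(1) assms(2) in \<open>auto simp: stable_def\<close>)
  have Q: "u - P u \<in> ?W'" if "u \<in> U" for u
    using that P(2) subspace_diff[OF sU that, of "P u"] P(1)[of u] assms(3) by auto
  define h where "h u = h1 (P u) + h2 (u - P u)" for u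
  have h1W: "h1 u \<in> W" if "u \<in> W" for u using h1(1) that by (auto simp: isometry_on_def)
  have h2W: "h2 u \<in> ?W'" if "u \<in> ?W'" for u
    using h2(1) that unfolding isometry_on_def by blast
  have "isometry_on U h"
    unfolding isometry_on_def
  proof (intro conjI ballI allI)
    fix u assume u: "u \<in> U"
    show "h u \<in> U"
      using subspace_add[OF sU, of "h1 (P u)" "h2 (u - P u)"] h1W[OF P(1)[of u]] h2W[OF Q[OF u]] assms(3)
      by (auto simp: h_def)
    fix a 
    have "h2 (scale a (u - P u)) = scale a (h2 (u - P u))"
      using h2(1) Q[OF u] unfolding isometry_on_def by blast
    moreover have "h1 (scale a (P u)) = scale a (h1 (P u))"
      using h1(1) P(1) unfolding isometry_on_def by blast
    ultimately show "h (scale a u) = scale a (h u)"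
      by (simp add: h_def P_scale scale_right_distrib scale_right_diff_distrib)
  next
    fix u v assume u: "u \<in> U" and v: "v \<in> U"
    have "h2 ((u - P u) + (v - P v)) = h2 (u - P u) + h2 (v - P v)"
      using h2(1) Q[OF u] Q[OF v] unfolding isometry_on_def by blast
    moreover have "h1 (P u + P v) = h1 (P u) + h1 (P v)"
      using h1(1) P(1) unfolding isometry_on_def by blast
    ultimately show "h (u + v) = h u + h v"
      by (simp add: h_def P_add algebra_simps)
    have "B (h2 (u - P u)) (h2 (v - P v)) = B (u - P u) (v - P v)"
      using h2(1) Q[OF u] Q[OF v] unfolding isometry_on_def by blast
    moreover have "B (h1 (P u)) (h1 (P v)) = B (P u) (P v)"
      using h1(1) P(1) unfolding isometry_on_def by blast
    moreover have "B (h2 (u - P u)) (h1 (P v)) = 0" "B (h2 (v - P v)) (h1 (P u)) = 0"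
      using h2W[OF Q[OF u]] h2W[OF Q[OF v]] h1W[OF P(1)] by auto
    ultimately have "B (h u) (h v) = B (P u) (P v) + B (u - P u) (v - P v)"
      by (simp add: h_def B_simps B_sym[of "h1 (P u)"])
    also have "\<dots> = B (P u + (u - P u)) (P v + (v - P v))"
      using P(2)[of "P v" u] P(2)[of "P u" v] P(1)
      by (simp only: B_add B_add_right B_sym[of "P u" "v - P v"]) simp
    finally show "B (h u) (h v) = B u v" by simp
  qed
  moreover have "h (g u) = g' (h u)" if "u \<in> U" for u
  proof -
    have "h2 (g (u - P u)) = g' (h2 (u - P u))" using h2(2) Q[OF that] by blast
    then show ?thesis using h1(2)[OF P(1)[of u]] by (simp add: h_def P_g g_diff g'_add)
  qed
  ultimately show ?thesis by (auto simp: reversible_def)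
qed

section \<open>Spaces generated by two vectors under \<open>g\<close> and \<open>g'\<close>\<close>

definition cyclic_pair :: "'v \<Rightarrow> 'v \<Rightarrow> 'v set" where
  "cyclic_pair x y = {poly_act p x + poly_act q (d x) + poly_act r y + poly_act t (d y) | p q r t. True}"

lemma cyclic_pairI:
  "u = poly_act p x + poly_act q (d x) + poly_act r y + poly_act t (d y) \<Longrightarrow> u \<in> cyclic_pair x y"
  unfolding cyclic_pair_def by blast

lemma cyclic_pairE:
  assumes "u \<in> cyclic_pair x y"
  obtains p q r t where "u = poly_act p x + poly_act q (d x) + poly_act r y + poly_act t (d y)"
  using assms unfolding cyclic_pair_def by blast

lemma B_act_act: "B (poly_act p u) (poly_act q v) = B (poly_act (p * q) u) v"
  by (simp add: B_act[of q, symmetric] poly_act_mult[symmetric] mult.commute)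

lemma B_act_d_right: "B (poly_act p u) (poly_act q (d v)) = - B (poly_act (p * q) (d u)) v"
proof -
  have "B (poly_act p u) (poly_act q (d v)) = B (poly_act (p * q) u) (d v)"
    by (rule B_act_act)
  also have "\<dots> = - B (d (poly_act (p * q) u)) v"
    by (simp add: B_d)
  finally show ?thesis by (simp add: act_d)
qed

lemma B_act_d: "B (poly_act p x) (poly_act q (d x)) = 0"
  by (simp add: B_act_d_right B_act_d_self)

lemma B_act_d_d: "B (poly_act p (d u)) (poly_act q (d v)) = - B (poly_act (p * q * D) u) v"
  by (simp add: B_act_d_right dd poly_act_mult)

lemma act_diff: "poly_act (p - q) u = poly_act p u - poly_act q u"
  by (rule act.scale_left_diff_distrib)

text \<open>\<open>c\<close> multiplies every coefficient by X. \<open>d\<close> exchanges the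
  coefficients of \<open>x\<close> and \<open>d x\<close>, and those of \<open>y\<close> and
  \<open>d y\<close>, up to a factor \<open>D\<close>. Then \<open>g_eq\<close> applies.\<close>

lemma stable_cyclic_pair: "stable (cyclic_pair x y)"
proof -
  have sub: "subspace (cyclic_pair x y)"
    unfolding subspace_def
  proof (intro conjI allI ballI)
    show "0 \<in> cyclic_pair x y"
      by (rule cyclic_pairI[of _ 0 _ 0 0 _ 0]) simp
  next
    fix u v assume u: "u \<in> cyclic_pair x y" and v: "v \<in> cyclic_pair x y"
    obtain p q r t where
      1: "u = poly_act p x + poly_act q (d x) + poly_act r y + poly_act t (d y)"
      using u by (rule cyclic_pairE)
    obtain p' q' r' t' where
      2: "v = poly_act p' x + poly_act q' (d x) + poly_act r' y + poly_act t' (d y)"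
      using v by (rule cyclic_pairE)
    show "u + v \<in> cyclic_pair x y"
      by (rule cyclic_pairI[of _ "p + p'" _ "q + q'" "r + r'" _ "t + t'"]) (simp add: 1 2 poly_act_add)
  next
    fix a u assume "u \<in> cyclic_pair x y"
    then obtain p q r t where
      u: "u = poly_act p x + poly_act q (d x) + poly_act r y + poly_act t (d y)"
      by (rule cyclic_pairE)
    show "scale a u \<in> cyclic_pair x y"
      by (rule cyclic_pairI[of _ "Polynomial.smult a p" _ "Polynomial.smult a q"
            "Polynomial.smult a r" _ "Polynomial.smult a t"])
        (simp add: u poly_act_smult scale_right_distrib)
  qed
  have c: "c u \<in> cyclic_pair x y" if "u \<in> cyclic_pair x y" for u
  proof -
    obtain p q r t where
      u: "u = poly_act p x + poly_act q (d x) + poly_act r y + poly_act t (d y)"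
      using \<open>u \<in> cyclic_pair x y\<close> by (rule cyclic_pairE)
    show ?thesis
      by (rule cyclic_pairI[of _ "pCons 0 p" _ "pCons 0 q" "pCons 0 r" _ "pCons 0 t"]) (simp add: u c_add)
  qed
  have d: "d u \<in> cyclic_pair x y" if "u \<in> cyclic_pair x y" for u
  proof -
    obtain p q r t where
      u: "u = poly_act p x + poly_act q (d x) + poly_act r y + poly_act t (d y)"
      using \<open>u \<in> cyclic_pair x y\<close> by (rule cyclic_pairE)
    show ?thesis
      by (rule cyclic_pairI[of _ "q * D" _ p "t * D" _ r])
        (simp add: u d_add act_d[symmetric] dd poly_act_mult)
  qed
  have "g u \<in> cyclic_pair x y" "g' u \<in> cyclic_pair x y" if "u \<in> cyclic_pair x y" for u
    using subspace_scale[OF sub subspace_add[OF sub c[OF that] d[OF that]], of "1/2"]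
      subspace_scale[OF sub subspace_diff[OF sub c[OF that] d[OF that]], of "1/2"]
    by (metis g_eq(1), metis g_eq(2))
  then show ?thesis
    using sub by (simp add: stable_def)
qed

lemma cyclic_pair_subset:
  assumes "stable U" "x \<in> U" "y \<in> U"
  shows "cyclic_pair x y \<subseteq> U"
proof -
  have "subspace U" using assms(1) by (simp add: stable_def)
  then show ?thesis
    using assms by (auto simp: cyclic_pair_def intro!: subspace_add stable_act stable_d)
qed

lemma mem_cyclic_pair: "poly_act p x \<in> cyclic_pair x y" "poly_act p (d x) \<in> cyclic_pair x y"
  "poly_act p y \<in> cyclic_pair x y" "poly_act p (d y) \<in> cyclic_pair x y"
  by (rule cyclic_pairI[of _ p _ 0 0 _ 0], simp) (rule cyclic_pairI[of _ 0 _ p 0 _ 0], simp,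
    rule cyclic_pairI[of _ 0 _ 0 p _ 0], simp, rule cyclic_pairI[of _ 0 _ 0 0 _ p], simp)

text \<open>The map fixes \<open>x\<close>, negates \<open>y\<close>, commutes with \<open>c\<close>
  and anticommutes with \<open>d\<close>, so it changes the signs of \<open>q\<close> and
  \<open>r\<close>. The terms from \<open>x\<close> and \<open>d y\<close>, which keep their sign,
  are orthogonal to those from \<open>d x\<close> and \<open>y\<close>, so \<open>B\<close> is
  preserved.\<close>

lemma reversible_cyclic_pair:
  assumes nd: "nondegenerate_on (cyclic_pair x y)" and xy: "\<And>s. B (poly_act s x) y = 0"
  shows "reversible (cyclic_pair x y)"
proof -
  let ?U = "cyclic_pair x y"
  define v where "v p q r t = poly_act p x + poly_act q (d x) + poly_act r y + poly_act t (d y)" for p q r t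
  have vU: "v p q r t \<in> ?U" for p q r t unfolding v_def by (rule cyclic_pairI) (rule refl)
  have Uv: "\<exists>p q r t. u = v p q r t" if "u \<in> ?U" for u using that unfolding v_def by (elim cyclic_pairE) blast
  have v_add: "v p q r t + v p' q' r' t' = v (p + p') (q + q') (r + r') (t + t')" for p q r t p' q' r' t'
    by (simp add: v_def poly_act_add)
  have v_diff: "v p q r t - v p' q' r' t' = v (p - p') (q - q') (r - r') (t - t')" for p q r t p' q' r' t'
    by (simp add: v_def act_diff)
  have v_scale: "scale a (v p q r t) = v (Polynomial.smult a p) (Polynomial.smult a q)
      (Polynomial.smult a r) (Polynomial.smult a t)" for a p q r t
    by (simp add: v_def poly_act_smult scale_right_distrib)
  have z1: "B (poly_act p x) (poly_act q y) = 0" for p q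
    by (simp add: B_act_act xy)
  have z2: "B (poly_act p (d x)) (poly_act q (d y)) = 0" for p q
    by (simp add: B_act_d_d xy)
  have z3: "B (poly_act p y) (poly_act q x) = 0" "B (poly_act p (d y)) (poly_act q (d x)) = 0" for p q
    using z1 z2 B_sym by metis+
  have z4: "B (poly_act p (d u)) (poly_act q u) = 0" for p q u
    using B_act_d B_sym by metis
  have iso: "B (v p (- q) (- r) t) (v p' (- q') (- r') t') = B (v p q r t) (v p' q' r' t')" for p q r t p' q' r' t'
    by (simp add: v_def B_simps z1 z2 z3 z4 B_act_d)
  \<comment> \<open>The coefficients are not determined by the vector. If a combination is zero, its
    sign-changed version is orthogonal to the whole space by \<open>iso\<close>, hence zero by
    nondegeneracy.\<close>
  have wd: "v p (- q) (- r) t = v p' (- q') (- r') t'" if "v p q r t = v p' q' r' t'" for p q r t p' q' r' t'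
  proof -
    let ?w = "v (p - p') (- (q - q')) (- (r - r')) (t - t')"
    have 0: "v (p - p') (q - q') (r - r') (t - t') = 0"
      using that by (simp add: v_diff[symmetric])
    have "B ?w u = 0" if "u \<in> ?U" for u
    proof -
      obtain p1 q1 r1 t1 where "u = v p1 (- (- q1)) (- (- r1)) t1" using Uv[OF \<open>u \<in> ?U\<close>] by auto
      then show ?thesis by (metis iso 0 B_0(1))
    qed
    then have "?w = 0" using nd vU unfolding nondegenerate_on_def by blast
    moreover have "?w = v p (- q) (- r) t - v p' (- q') (- r') t'" by (simp add: v_diff)
    ultimately show ?thesis by simp
  qed
  define h where "h u = (SOME w. \<exists>p q r t. u = v p q r t \<and> w = v p (- q) (- r) t)" for u
  have h: "h (v p q r t) = v p (- q) (- r) t" for p q r t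
    unfolding h_def
  proof (rule some_equality)
    fix w assume "\<exists>p' q' r' t'. v p q r t = v p' q' r' t' \<and> w = v p' (- q') (- r') t'"
    then show "w = v p (- q) (- r) t" by (elim exE conjE) (simp add: wd[of p q r t])
  qed (rule exI[of _ p], rule exI[of _ q], rule exI[of _ r], rule exI[of _ t], simp)
  have "isometry_on ?U h"
    unfolding isometry_on_def
  proof (intro conjI ballI allI)
    fix u assume "u \<in> ?U"
    then obtain p q r t where u: "u = v p q r t" using Uv[OF \<open>u \<in> ?U\<close>] by auto
    show "h u \<in> ?U" by (simp add: u h vU)
    show "h (scale a u) = scale a (h u)" for a by (simp add: u h v_scale)
  next
    fix u w assume "u \<in> ?U" and "w \<in> ?U"
    then obtain p q r t p' q' r' t' where u: "u = v p q r t" "w = v p' q' r' t'"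
      using Uv[OF \<open>u \<in> ?U\<close>] Uv[OF \<open>w \<in> ?U\<close>] by auto
    show "h (u + w) = h u + h w" by (simp add: u h v_add)
    show "B (h u) (h w) = B u w" by (simp add: u h iso)
  qed
  moreover have "h (g u) = g' (h u)" if "u \<in> ?U" for u
  proof -
    obtain p q r t where u: "u = v p q r t" using Uv[OF \<open>u \<in> ?U\<close>] by auto
    have cv: "c (v p q r t) = v (pCons 0 p) (pCons 0 q) (pCons 0 r) (pCons 0 t)" for p q r t
      by (simp add: v_def c_add)
    have dv: "d (v p q r t) = v (q * D) p (t * D) r" for p q r t
      by (simp add: v_def d_add act_d[symmetric] dd poly_act_mult)
    have neg: "Polynomial.smult a (pCons 0 (- q) - p) = - Polynomial.smult a (pCons 0 q + p)"
      for a :: 'a and p q :: "'a poly"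
      by (simp flip: Polynomial.smult_minus_right)
    have "h (scale (1/2) (c u + d u)) = scale (1/2) (c (h u) - d (h u))"
      by (simp add: u cv dv v_add v_scale v_diff h neg)
    then show ?thesis
      by (simp only: g_eq(1)[of u] g_eq(2)[of "h u"])
  qed
  ultimately show ?thesis by (auto simp: reversible_def)
qed

end

section \<open>Orthogonally indecomposable spaces and the local ring F[c]\<close>

locale indecomposable_isometry = isometry scale B g g'
  for scale :: "'a::field \<Rightarrow> 'v::ab_group_add \<Rightarrow> 'v" and B g g' +
  fixes U :: "'v set"
  assumes fin: "finite U" and U_stable: "stable U" and nondeg: "nondegenerate_on U"
    and U_nonzero: "U \<noteq> {0}"
    and indecomposable: "W \<subseteq> U \<Longrightarrow> stable W \<Longrightarrow> nondegenerate_on W \<Longrightarrow> W = {0} \<or> W = U"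
begin

lemma subspace_U: "subspace U" using U_stable by (simp add: stable_def)

lemmas act_U = stable_act[OF U_stable] and d_U = stable_d[OF U_stable]

text \<open>The three predicates say that p(c) is zero, nilpotent or invertible on \<open>U\<close>,
  the inverse being taken inside F[c].\<close>

definition kills :: "'a poly \<Rightarrow> bool" where "kills p \<longleftrightarrow> (\<forall>u\<in>U. poly_act p u = 0)"
definition nilp :: "'a poly \<Rightarrow> bool" where "nilp p \<longleftrightarrow> (\<exists>M. kills (p ^ M))"
definition invp :: "'a poly \<Rightarrow> bool" where "invp p \<longleftrightarrow> (\<exists>q. \<forall>u\<in>U. poly_act (p * q) u = u)"

lemma obtain_nonzero: obtains u where "u \<in> U" "u \<noteq> 0"
  using U_nonzero subspace_0[OF subspace_U] by blast

lemma kills_mult: "kills p \<Longrightarrow> kills (p * q)"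
  by (auto simp: kills_def poly_act_mult act_U)

lemma not_kills_1: "\<not> kills 1"
  by (metis act.scale_one kills_def obtain_nonzero)

text \<open>By the pigeonhole principle the powers of p(c), as maps of the finite set
  \<open>U\<close>, are eventually periodic.\<close>

lemma idempotent_power: "\<exists>M\<ge>1. \<forall>u\<in>U. poly_act (p ^ M * p ^ M) u = poly_act (p ^ M) u"
proof -
  have "range (\<lambda>i. restrict (poly_act (p ^ i)) U) \<subseteq> PiE U (\<lambda>_. U)"
    using act_U by auto
  then have "finite (range (\<lambda>i. restrict (poly_act (p ^ i)) U))"
    using finite_PiE[OF fin, of "\<lambda>_. U"] fin finite_subset by blast
  then have "\<not> inj (\<lambda>i::nat. restrict (poly_act (p ^ i)) U)"
    using finite_imageD infinite_UNIV_nat by blast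
  then obtain i j :: nat where ij: "i < j" "restrict (poly_act (p ^ i)) U = restrict (poly_act (p ^ j)) U"
    unfolding inj_def by (metis nat_neq_iff)
  define t where "t = j - i"
  have step: "poly_act (p ^ (i + t)) u = poly_act (p ^ i) u" if "u \<in> U" for u
    using fun_cong[OF ij(2), of u] that ij(1) by (simp add: t_def)
  have per: "poly_act (p ^ (i + n + t * k)) u = poly_act (p ^ (i + n)) u" if "u \<in> U" for u n k
  proof (induction k)
    case (Suc k)
    have "poly_act (p ^ (i + n + t * Suc k)) u = poly_act (p ^ (i + t)) (poly_act (p ^ (n + t * k)) u)"
      by (simp add: poly_act_mult[symmetric] power_add[symmetric] algebra_simps)
    also have "\<dots> = poly_act (p ^ (i + n + t * k)) u"
      by (subst step) (simp_all add: that act_U poly_act_mult[symmetric] power_add[symmetric] algebra_simps)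
    finally show ?case using Suc by simp
  qed simp
  \<comment> \<open>A multiple of the period \<open>t\<close> that is at least the preperiod
    \<open>i\<close>: doubling such an exponent does not change the operator.\<close>
  let ?M = "t * (i + 1)"
  have "i \<le> 1 * (i + 1)" by simp
  also have "\<dots> \<le> ?M" using ij(1) t_def by (intro mult_le_mono1) simp
  finally have "i \<le> ?M" .
  then obtain n where n: "?M = i + n" using le_Suc_ex by blast
  have "poly_act (p ^ ?M * p ^ ?M) u = poly_act (p ^ ?M) u" if "u \<in> U" for u
    using per[OF that, of n "i + 1"] by (metis n power_add)
  moreover have "?M \<ge> 1" using ij(1) by (simp add: t_def)
  ultimately show ?thesis by blast
qed

text \<open>Fitting's argument: an idempotent power of p(c) is self-adjoint and commutes with
  \<open>g\<close>, so its image \<open>W\<close> is stable and nondegenerate. By indecomposability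
  the idempotent is zero or the identity.\<close>

lemma nilp_or_invp: "nilp p \<or> invp p"
proof -
  obtain M where M: "M \<ge> 1" "\<And>u. u \<in> U \<Longrightarrow> poly_act (p ^ M * p ^ M) u = poly_act (p ^ M) u"
    using idempotent_power by blast
  let ?e = "p ^ M"
  define W where "W = {u\<in>U. poly_act ?e u = u}"
  have "subspace W"
    using subspace_U by (auto simp: W_def subspace_def poly_act_right_add poly_act_scale)
  moreover have "g u \<in> W" "g' u \<in> W" if "u \<in> W" for u
  proof -
    have 1: "poly_act ?e (d u) = d u" "poly_act ?e (c u) = c u"
      using that by (auto simp: W_def act_d poly_act_f)
    then have "poly_act ?e (g u) = g u" "poly_act ?e (g' u) = g' u"
      by (simp_all only: g_eq(1)[of u] g_eq(2)[of u] poly_act_scale poly_act_right_add act.scale_right_diff_distrib)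
    then show "g u \<in> W" "g' u \<in> W" using that U_stable by (auto simp: W_def stable_def)
  qed
  ultimately have "stable W" by (auto simp: stable_def)
  moreover have "nondegenerate_on W"
    unfolding nondegenerate_on_def
  proof safe
    fix u assume u: "u \<in> W" "\<forall>v\<in>W. B u v = 0"
    have "B u v = 0" if "v \<in> U" for v
    proof -
      have "poly_act ?e v \<in> W" using that M(2) by (simp add: W_def act_U poly_act_mult)
      moreover have "B u v = B u (poly_act ?e v)" using u(1) by (metis (mono_tags, lifting) B_act W_def mem_Collect_eq)
      ultimately show ?thesis using u(2) by simp
    qed
    then show "u = 0" using nondeg u(1) by (auto simp: nondegenerate_on_def W_def)
  qed
  ultimately consider "W = {0}" | "W = U" using indecomposable[of W] by (auto simp: W_def)
  then show ?thesis
  proof cases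
    case 1
    have "poly_act ?e u = 0" if "u \<in> U" for u
    proof -
      have "poly_act ?e u \<in> W" using that M(2) by (simp add: W_def act_U poly_act_mult)
      then show ?thesis using 1 by simp
    qed
    then show ?thesis by (auto simp: nilp_def kills_def)
  next
    case 2
    have "p * p ^ (M - 1) = ?e" using M(1) by (cases M) simp_all
    then have "poly_act (p * p ^ (M - 1)) u = u" if "u \<in> U" for u
      using 2 that W_def by auto
    then have "invp p" unfolding invp_def by blast
    then show ?thesis ..
  qed
qed

lemma nilp_kernel:
  assumes "nilp p" "u \<in> U" "u \<noteq> 0"
  shows "\<exists>k. poly_act (p ^ k) u \<noteq> 0 \<and> poly_act p (poly_act (p ^ k) u) = 0"
proof -
  have ex: "\<exists>k. poly_act (p ^ k) u = 0" using assms by (auto simp: nilp_def kills_def)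
  define k where "k = (LEAST k. poly_act (p ^ k) u = 0)"
  have k: "poly_act (p ^ k) u = 0" "\<And>j. j < k \<Longrightarrow> poly_act (p ^ j) u \<noteq> 0"
    unfolding k_def using LeastI_ex[OF ex] not_less_Least by auto
  have "k \<noteq> 0" using k(1) assms(3) by (metis act.scale_one power_0)
  then obtain j where "k = Suc j" using not0_implies_Suc by blast
  then show ?thesis using k by (intro exI[of _ j]) (auto simp: poly_act_mult)
qed

lemma invp_iff: "invp p \<longleftrightarrow> \<not> nilp p"
proof -
  have False if "invp p" "nilp p"
  proof -
    obtain q where q: "\<And>u. u \<in> U \<Longrightarrow> poly_act (p * q) u = u"
      using \<open>invp p\<close> unfolding invp_def by blast
    obtain u where u: "u \<in> U" "u \<noteq> 0" by (rule obtain_nonzero)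
    obtain k where k: "poly_act (p ^ k) u \<noteq> 0" "poly_act p (poly_act (p ^ k) u) = 0"
      using nilp_kernel[OF \<open>nilp p\<close> u] by blast
    have "poly_act (p ^ k) u = poly_act (q * p) (poly_act (p ^ k) u)"
      using q[OF act_U[OF u(1)]] by (simp add: mult.commute)
    then show False using k by (simp add: poly_act_mult)
  qed
  then show ?thesis using nilp_or_invp by blast
qed

text \<open>Commuting nilpotent operators have a common nonzero kernel vector. The sum kills it too,
  so the sum is not invertible.\<close>

lemma nilp_add:
  assumes "nilp p" "nilp q" shows "nilp (p + q)"
proof (rule ccontr)
  assume "\<not> nilp (p + q)"
  then obtain s where s: "\<And>u. u \<in> U \<Longrightarrow> poly_act ((p + q) * s) u = u"
    using invp_iff[of "p + q"] unfolding invp_def by blast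
  obtain u where u: "u \<in> U" "u \<noteq> 0" by (rule obtain_nonzero)
  obtain k where k: "poly_act (p ^ k) u \<noteq> 0" "poly_act p (poly_act (p ^ k) u) = 0"
    using nilp_kernel[OF assms(1) u] by blast
  let ?u = "poly_act (p ^ k) u"
  obtain j where j: "poly_act (q ^ j) ?u \<noteq> 0" "poly_act q (poly_act (q ^ j) ?u) = 0"
    using nilp_kernel[OF assms(2) act_U[OF u(1)] k(1)] by blast
  let ?w = "poly_act (q ^ j) ?u"
  have "poly_act p ?w = poly_act (q ^ j) (poly_act p ?u)"
    by (simp add: poly_act_mult[symmetric] mult_ac)
  then have "poly_act (p + q) ?w = 0" using k(2) j(2) by (simp add: poly_act_add)
  then have "poly_act (s * (p + q)) ?w = 0" by (simp add: poly_act_mult)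
  then show False using s[of ?w] j(1) u(1) act_U by (simp add: mult.commute)
qed

lemma nilp_mult: "nilp p \<Longrightarrow> nilp (p * q)"
  by (auto simp: nilp_def power_mult_distrib intro: kills_mult)

lemma invp_mult: "invp p \<Longrightarrow> invp q \<Longrightarrow> invp (p * q)"
proof -
  assume p: "invp p" and q: "invp q"
  obtain p' where pq1: "\<And>u. u \<in> U \<Longrightarrow> poly_act (p * p') u = u"
    using p unfolding invp_def by blast
  obtain q' where pq2: "\<And>u. u \<in> U \<Longrightarrow> poly_act (q * q') u = u"
    using q unfolding invp_def by blast
  have "poly_act (p * q * (p' * q')) u = u" if "u \<in> U" for u
  proof -
    have "poly_act (p * q * (p' * q')) u = poly_act (p * p') (poly_act (q * q') u)"
      by (simp add: poly_act_mult[symmetric] mult_ac)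
    then show ?thesis using that pq1 pq2 by simp
  qed
  then show "invp (p * q)" by (auto simp: invp_def)
qed

lemma invp_const: "a \<noteq> 0 \<Longrightarrow> invp [:a:]"
  unfolding invp_def by (intro exI[of _ "[:1/a:]"]) simp

text \<open>The nilpotent polynomials form an ideal, generated by a nonzero member of least degree.
  One exists because some power X^M acts as an idempotent, so X^(2M) - X^M acts as zero.\<close>

lemma ex_generator: "\<exists>\<phi>. \<phi> \<noteq> 0 \<and> nilp \<phi> \<and> (\<forall>p. nilp p \<longrightarrow> \<phi> dvd p)"
proof -
  have "\<exists>p. p \<noteq> 0 \<and> nilp p"
  proof -
    let ?X = "[:0, 1:] :: 'a poly"
    obtain M where M: "M \<ge> 1" "\<And>u. u \<in> U \<Longrightarrow> poly_act (?X ^ M * ?X ^ M) u = poly_act (?X ^ M) u"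
      using idempotent_power by blast
    have "kills (?X ^ M * ?X ^ M - ?X ^ M)" using M(2) by (auto simp: kills_def act_diff)
    moreover have "?X ^ M * ?X ^ M - ?X ^ M \<noteq> 0"
    proof
      assume "?X ^ M * ?X ^ M - ?X ^ M = 0"
      then have "degree (?X ^ M * ?X ^ M) = degree (?X ^ M)" by simp
      then show False using M(1) by (simp add: degree_mult_eq degree_power_eq)
    qed
    ultimately show ?thesis by (metis nilp_def power_one_right)
  qed
  then obtain p0 where "p0 \<noteq> 0 \<and> nilp p0" ..
  from ex_has_least_nat[of "\<lambda>p. p \<noteq> 0 \<and> nilp p", OF this, of degree]
  obtain \<phi> where \<phi>: "\<phi> \<noteq> 0" "nilp \<phi>" "\<And>p. p \<noteq> 0 \<Longrightarrow> nilp p \<Longrightarrow> degree \<phi> \<le> degree p"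
    by auto
  have "\<phi> dvd p" if "nilp p" for p
  proof -
    have "nilp (p + \<phi> * (- (p div \<phi>)))" using that \<phi>(2) by (intro nilp_add nilp_mult)
    also have "p + \<phi> * (- (p div \<phi>)) = p mod \<phi>" by (simp flip: minus_mult_div_eq_mod)
    finally have "nilp (p mod \<phi>)" .
    then have "p mod \<phi> = 0" using \<phi>(1) \<phi>(3)[of "p mod \<phi>"] degree_mod_less[of \<phi> p] by fastforce
    then show ?thesis by (simp add: mod_eq_0_iff_dvd)
  qed
  then show ?thesis using \<phi> by blast
qed

text \<open>The operators \<open>F[c]\<close> on \<open>U\<close> form a local ring; \<open>\<phi>\<close> generates its maximal ideal and \<open>\<phi>\<^sup>l\<close> its
  socle.\<close>

definition \<phi> :: "'a poly" where
  "\<phi> = (SOME \<phi>. \<phi> \<noteq> 0 \<and> nilp \<phi> \<and> (\<forall>p. nilp p \<longrightarrow> \<phi> dvd p))"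

definition l :: nat where "l = (LEAST M. kills (\<phi> ^ Suc M))"

lemma \<phi>: "\<phi> \<noteq> 0" "nilp \<phi>" "nilp p \<Longrightarrow> \<phi> dvd p"
  using someI_ex[OF ex_generator] unfolding \<phi>_def by blast+

text \<open>\<open>l + 1\<close> is the nilpotency index of \<open>\<phi>\<close> on
  \<open>U\<close>; the index is positive because \<open>U\<close> is nonzero.\<close>

lemma not_kills_power_l: "\<not> kills (\<phi> ^ l)"
  and kills_power: "n > l \<Longrightarrow> kills (\<phi> ^ n)"
proof -
  obtain M where M: "kills (\<phi> ^ M)" using \<phi>(2) by (auto simp: nilp_def)
  then have "M \<noteq> 0" using not_kills_1 by (intro notI) simp
  then have "\<exists>M. kills (\<phi> ^ Suc M)" using M by (metis not0_implies_Suc)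
  then have 1: "kills (\<phi> ^ Suc l)" unfolding l_def by (rule LeastI_ex)
  show "\<not> kills (\<phi> ^ l)"
  proof (cases l)
    case 0
    then show ?thesis using not_kills_1 by simp
  next
    case (Suc n)
    then show ?thesis using not_less_Least[of n "\<lambda>M. kills (\<phi> ^ Suc M)"] by (simp add: l_def)
  qed
  show "kills (\<phi> ^ n)" if "n > l"
  proof -
    have "\<phi> ^ n = \<phi> ^ Suc l * \<phi> ^ (n - Suc l)" using that by (simp only: power_add[symmetric]) simp
    then show ?thesis using kills_mult[OF 1] by simp
  qed
qed

lemma kills_unit: "kills (p * b) \<Longrightarrow> invp b \<Longrightarrow> kills p"
proof -
  assume p: "kills (p * b)" and "invp b"
  then obtain q where q: "\<And>u. u \<in> U \<Longrightarrow> poly_act (b * q) u = u" unfolding invp_def by blast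
  show "kills p"
    unfolding kills_def
  proof
    fix u assume u: "u \<in> U"
    have "poly_act p u = poly_act p (poly_act (b * q) u)" using q[OF u] by simp
    also have "\<dots> = poly_act (p * b) (poly_act q u)" by (simp only: poly_act_mult)
    also have "\<dots> = 0" using p act_U[OF u] by (simp add: kills_def)
    finally show "poly_act p u = 0" .
  qed
qed

text \<open>Take the largest \<open>i\<close> up to \<open>l\<close> with \<open>\<phi> ^ i\<close>
  dividing \<open>p\<close>. If \<open>\<phi>\<close> divided the cofactor, then \<open>i\<close>
  would not be maximal or, for \<open>i = l\<close>, \<open>p\<close> would act as zero. A cofactor
  not divisible by \<open>\<phi>\<close> is not nilpotent, hence invertible.\<close>

lemma factorization:
  assumes "\<not> kills p"
  shows "\<exists>i b. i \<le> l \<and> p = \<phi> ^ i * b \<and> invp b"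
proof -
  have ex: "finite {i. i \<le> l \<and> \<phi> ^ i dvd p}" "{i. i \<le> l \<and> \<phi> ^ i dvd p} \<noteq> {}"
    by (auto intro: exI[of _ 0])
  define i where "i = Max {i. i \<le> l \<and> \<phi> ^ i dvd p}"
  have i: "i \<le> l" "\<phi> ^ i dvd p" using Max_in[OF ex] by (auto simp: i_def)
  then obtain b where b: "p = \<phi> ^ i * b" by blast
  have "\<not> \<phi> dvd b"
  proof
    assume "\<phi> dvd b"
    then have dvd: "\<phi> ^ Suc i dvd p" by (simp add: b mult_dvd_mono mult.commute[of \<phi>])
    show False
    proof (cases "Suc i \<le> l")
      case True
      then have "Suc i \<le> i" unfolding i_def using dvd ex(1) by (intro Max_ge) (auto simp: i_def)
      then show False by simp
    next
      case False
      then have "kills (\<phi> ^ Suc i)" by (intro kills_power) simp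
      then have "kills p" using dvd kills_mult by (metis dvdE)
      then show False using assms by simp
    qed
  qed
  then have "invp b" using \<phi>(3) invp_iff by blast
  then show ?thesis using i b by blast
qed

text \<open>The functional sending s to B(s(c) w, z) is nonzero on the socle generator
  \<open>\<phi> ^ l\<close>, and every \<open>p\<close> acting nontrivially has a multiple acting as
  \<open>\<phi> ^ l\<close>. So its kernel contains no nonzero ideal: it is a Frobenius form on
  F[c].\<close>

lemma kills_if_functional_vanishes:
  assumes "w \<in> U" "B (poly_act (\<phi> ^ l) w) z \<noteq> 0" "\<And>s. B (poly_act (p * s) w) z = 0"
  shows "kills p"
proof (rule ccontr)
  assume "\<not> kills p"
  then obtain i b where b: "i \<le> l" "p = \<phi> ^ i * b" "invp b" using factorization by blast
  then obtain q where q: "\<And>u. u \<in> U \<Longrightarrow> poly_act (b * q) u = u" unfolding invp_def by blast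
  have "\<phi> ^ l = \<phi> ^ i * \<phi> ^ (l - i)" using b(1) by (simp flip: power_add)
  then have "p * (q * \<phi> ^ (l - i)) = \<phi> ^ l * (b * q)" by (simp only: b(2) mult_ac)
  then have "poly_act (p * (q * \<phi> ^ (l - i))) w = poly_act (\<phi> ^ l) (poly_act (b * q) w)"
    by (simp only: poly_act_mult)
  then have "poly_act (p * (q * \<phi> ^ (l - i))) w = poly_act (\<phi> ^ l) w"
    using q[OF assms(1)] by simp
  then show False using assms(2,3) by metis
qed

text \<open>X^2 - 4 has no repeated factor: if \<open>\<phi>\<close> divided \<open>D\<close> twice,
  it would divide (X/2) D' - D = 4, which is invertible.\<close>

lemma D_cases: "invp D \<or> (\<exists>b. D = \<phi> * b \<and> invp b)"
proof (rule ccontr)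
  assume neg: "\<not> ?thesis"
  then have "\<phi> dvd D" using \<phi>(3) invp_iff by blast
  then obtain b where b: "D = \<phi> * b" by blast
  then have "\<phi> dvd b" using neg \<phi>(3) invp_iff by blast
  then have "\<phi> dvd pderiv D" by (simp add: b pderiv_mult)
  then have "\<phi> dvd pderiv D * [:0, 1/2:] - D"
    using \<open>\<phi> dvd D\<close> by (intro dvd_diff dvd_mult2)
  moreover have "pderiv D * [:0, 1/2:] - D = [:4:]" using two by (simp add: D_def pderiv_pCons)
  ultimately obtain e where e: "[:4:] = \<phi> * e" by (metis dvdE)
  have "nilp [:4:]" unfolding e using \<phi>(2) by (rule nilp_mult)
  moreover have "(4::'a) \<noteq> 0" using two by (metis mult_2 mult_eq_0_iff numeral_Bit0 numeral_code(2))
  ultimately show False using invp_const invp_iff by blast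
qed

text \<open>\<open>D\<close> is nilpotent here, so one of its factors X - 2 and X + 2 is nilpotent
  and hence divisible by \<open>\<phi>\<close>.\<close>

lemma \<phi>_linear:
  assumes "D = \<phi> * b"
  shows "degree \<phi> = 1"
proof -
  have "D = [:-2, 1:] * [:2, 1:]" by (simp add: D_def)
  moreover have "nilp D" unfolding assms using \<phi>(2) by (rule nilp_mult)
  then have "\<not> invp D" by (simp add: invp_iff)
  ultimately have "\<not> invp [:-2, 1:] \<or> \<not> invp [:2, 1:]" using invp_mult by metis
  then have "\<phi> dvd [:-2, 1:] \<or> \<phi> dvd [:2, 1:]" using invp_iff \<phi>(3) by blast
  then have "degree \<phi> \<le> 1" by (auto dest: dvd_imp_degree_le)
  moreover have "degree \<phi> \<noteq> 0"
  proof
    assume "degree \<phi> = 0"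
    then obtain a where "\<phi> = [:a:]" by (rule degree_eq_zeroE)
    then show False using \<phi>(1,2) invp_const[of a] invp_iff by auto
  qed
  ultimately show ?thesis by simp
qed

lemma nondeg_witness:
  assumes "u \<in> U" "u \<noteq> 0"
  obtains v where "v \<in> U" "B u v \<noteq> 0"
  using nondeg assms unfolding nondegenerate_on_def by blast

text \<open>Polarization of the form B(\<phi>^l u, v), which is symmetric because
  \<open>\<phi> ^ l\<close> is self-adjoint and nonzero because \<open>B\<close> is
  nondegenerate.\<close>

lemma ex_anisotropic: "\<exists>x\<in>U. B (poly_act (\<phi> ^ l) x) x \<noteq> 0"
proof (rule ccontr)
  assume "\<not> ?thesis"
  then have neg: "\<And>x. x \<in> U \<Longrightarrow> B (poly_act (\<phi> ^ l) x) x = 0" by blast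
  obtain u where u: "u \<in> U" "poly_act (\<phi> ^ l) u \<noteq> 0"
    using not_kills_power_l unfolding kills_def by blast
  obtain v where v: "v \<in> U" "B (poly_act (\<phi> ^ l) u) v \<noteq> 0"
    using nondeg_witness act_U u by metis
  have "B (poly_act (\<phi> ^ l) (u + v)) (u + v) = 0"
    using neg u v subspace_add[OF subspace_U] by blast
  moreover have "B (poly_act (\<phi> ^ l) v) u = B (poly_act (\<phi> ^ l) u) v"
    by (metis B_act B_sym)
  ultimately have "B (poly_act (\<phi> ^ l) u) v + B (poly_act (\<phi> ^ l) u) v = 0"
    using neg[OF u(1)] neg[OF v(1)] by (simp add: poly_act_right_add B_simps)
  then show False using v(2) by (metis eq_minus_imp_0 eq_neg_iff_add_eq_0)
qed

text \<open>One generator suffices: the space generated by \<open>x\<close> is nondegenerate, hence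
  equals \<open>U\<close>. Pairing an element \<open>p x + q (d x)\<close> of its radical with F[c]
  x and F[c] d x shows that \<open>p\<close> and \<open>q * D\<close> act as zero.\<close>

lemma reversible_if_anisotropic:
  assumes x: "x \<in> U" "B (poly_act (\<phi> ^ l) x) x \<noteq> 0"
    and D: "invp D \<or> (\<exists>b. D = \<phi> * b \<and> invp b) \<and> (\<forall>u\<in>U. poly_act (\<phi> ^ l) (d u) = 0)"
  shows "reversible U"
proof -
  let ?W = "cyclic_pair x 0"
  have nd: "nondegenerate_on ?W"
    unfolding nondegenerate_on_def
  proof (intro ballI impI)
    fix z assume z: "z \<in> ?W" "\<forall>v\<in>?W. B z v = 0"
    obtain p q where pq: "z = poly_act p x + poly_act q (d x)"
      using z(1) by (elim cyclic_pairE) simp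
    have "B (poly_act (p * s) x) x = 0" for s
    proof -
      have "B z (poly_act s x) = 0" using z(2) mem_cyclic_pair by blast
      then show ?thesis
        by (simp add: pq B_simps B_act_act B_sym[of "poly_act q (d x)"] B_act_d B_act_d_self)
    qed
    then have p: "kills p" using x kills_if_functional_vanishes by blast
    have "B (poly_act (q * D * s) x) x = 0" for s
    proof -
      have "B z (poly_act s (d x)) = 0" using z(2) mem_cyclic_pair by blast
      then show ?thesis
        by (simp add: pq B_simps B_act_d B_act_d_d mult_ac)
    qed
    then have qD: "kills (q * D)" using x kills_if_functional_vanishes by blast
    \<comment> \<open>If \<open>D\<close> is invertible, \<open>q\<close> acts as zero. Otherwise
      \<open>D\<close> is \<open>\<phi>\<close> times a unit, so a \<open>q\<close> acting
      nontrivially is \<open>\<phi> ^ l\<close> times a unit, and \<open>\<phi> ^ l\<close> kills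
      the image of \<open>d\<close>.\<close>
    have "poly_act q (d x) = 0"
    proof (cases "kills q")
      case True
      then show ?thesis using d_U[OF x(1)] by (simp add: kills_def)
    next
      case False
      then obtain i b' where i: "i \<le> l" "q = \<phi> ^ i * b'" "invp b'" using factorization by blast
      have "\<not> invp D" using False qD kills_unit by blast
      then obtain b where b: "D = \<phi> * b" "invp b" and dl: "\<forall>u\<in>U. poly_act (\<phi> ^ l) (d u) = 0"
        using D by blast
      have "kills (\<phi> ^ Suc i * (b' * b))" using qD by (simp add: i b mult_ac)
      then have "kills (\<phi> ^ Suc i)" using kills_unit invp_mult i b by blast
      have "i = l"
      proof (rule ccontr)
        assume "i \<noteq> l"
        then have "\<phi> ^ l = \<phi> ^ Suc i * \<phi> ^ (l - Suc i)" using i(1)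
          by (simp only: power_add[symmetric]) simp
        then show False using kills_mult[OF \<open>kills (\<phi> ^ Suc i)\<close>] not_kills_power_l by simp
      qed
      then show ?thesis using dl x(1) by (simp add: i(2) mult.commute poly_act_mult)
    qed
    then show "z = 0" using p x(1) by (simp add: pq kills_def)
  qed
  have "x \<in> ?W" using mem_cyclic_pair(1)[of 1 x 0] by simp
  moreover have "x \<noteq> 0" using x(2) by auto
  moreover have "?W \<subseteq> U" using cyclic_pair_subset U_stable x(1) subspace_0[OF subspace_U] by blast
  ultimately have "?W = U" using indecomposable[OF _ stable_cyclic_pair nd] by blast
  then show ?thesis using reversible_cyclic_pair[OF nd] by simp
qed

text \<open>Here \<open>\<phi>\<close> is linear, so the values of \<open>s \<mapsto> B (s x) y\<close> on the powers of \<open>\<phi>\<close> can be cleared one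
  after another by adding multiples of \<open>\<phi>\<^sup>j d y\<close> to \<open>y\<close>.\<close>

lemma ex_orthogonal_partner:
  assumes x: "x \<in> U" and y0: "y0 \<in> U" "B (poly_act (\<phi> ^ l) (d x)) y0 \<noteq> 0" and D: "D = \<phi> * b"
  shows "\<exists>y\<in>U. B (poly_act (\<phi> ^ l) (d x)) y \<noteq> 0 \<and> (\<forall>s. B (poly_act s x) y = 0)"
proof -
  have "\<exists>y\<in>U. B (poly_act (\<phi> ^ l) (d x)) y \<noteq> 0 \<and> (\<forall>s. B (poly_act (\<phi> ^ (Suc l - j) * s) x) y = 0)"
    if "j \<le> Suc l" for j
    using that
  proof (induction j)
    case 0
    have "poly_act (\<phi> ^ Suc l * s) x = 0" for s
      using kills_mult[OF kills_power[of "Suc l"]] x by (simp add: kills_def)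
    then show ?case using y0 by auto
  next
    case (Suc j)
    then obtain y where y: "y \<in> U" "B (poly_act (\<phi> ^ l) (d x)) y \<noteq> 0"
      "\<And>s. B (poly_act (\<phi> ^ (Suc l - j) * s) x) y = 0" by auto
    define t where "t = l - j"
    have t: "Suc l - j = Suc t" "Suc l - Suc j = t" "t + j = l" using Suc.prems by (auto simp: t_def)
    \<comment> \<open>As \<open>t + j = l\<close>, pairing \<phi>^t x with \<phi>^j d y gives
      -B(\<phi>^l d x, y), so this multiple cancels the value at \<phi>^t.\<close>
    let ?m = "B (poly_act (\<phi> ^ t) x) y / B (poly_act (\<phi> ^ l) (d x)) y"
    let ?y = "y + scale ?m (poly_act (\<phi> ^ j) (d y))"
    have const: "\<exists>a. s = [:a:] + \<phi> * (s div \<phi>)" for s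
    proof -
      have "degree (s mod \<phi>) = 0"
        using degree_mod_less[of \<phi> s] \<phi>_linear[OF D] \<phi>(1) by auto
      then obtain a where "s mod \<phi> = [:a:]" by (rule degree_eq_zeroE)
      then show ?thesis by (metis mod_mult_div_eq)
    qed
    have "B (poly_act (\<phi> ^ t * s) x) ?y = 0" for s
    proof -
      obtain a where a: "s = [:a:] + \<phi> * (s div \<phi>)" using const by blast
      define s' where "s' = s div \<phi>"
      have "\<phi> ^ t * s = Polynomial.smult a (\<phi> ^ t) + \<phi> ^ Suc t * s'"
        by (subst a) (simp add: s'_def algebra_simps)
      then have 1: "B (poly_act (\<phi> ^ t * s) x) y = a * B (poly_act (\<phi> ^ t) x) y"
        using y(3)[of s'] by (simp add: poly_act_add poly_act_smult B_simps t(1))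
      have pw: "\<phi> ^ l = \<phi> ^ t * \<phi> ^ j" by (simp flip: t(3) add: power_add)
      have e: "\<phi> ^ t * s * \<phi> ^ j = Polynomial.smult a (\<phi> ^ l) + \<phi> ^ Suc l * s'"
        by (subst a) (simp add: s'_def pw algebra_simps)
      have "poly_act (\<phi> ^ Suc l * s') (d x) = 0"
        using kills_mult[OF kills_power[of "Suc l"]] d_U[OF x] by (simp add: kills_def)
      then have "B (poly_act (\<phi> ^ t * s) x) (poly_act (\<phi> ^ j) (d y))
          = - (a * B (poly_act (\<phi> ^ l) (d x)) y)"
        by (simp only: B_act_d_right e poly_act_add poly_act_smult B_simps) simp
      then show ?thesis using 1 y(2) by (simp add: B_simps)
    qed
    \<comment> \<open>The correction does not change this value: it contributes a multiple of
      \<open>\<phi> ^ l * D\<close>, which acts as zero because \<open>\<phi>\<close> divides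
      \<open>D\<close>.\<close>
    moreover have "B (poly_act (\<phi> ^ l) (d x)) ?y \<noteq> 0"
    proof -
      have "\<phi> ^ l * \<phi> ^ j * D = \<phi> ^ Suc l * (\<phi> ^ j * b)" by (simp add: D mult_ac)
      moreover have "kills (\<phi> ^ Suc l * (\<phi> ^ j * b))"
        by (intro kills_mult kills_power) simp
      ultimately have "poly_act (\<phi> ^ l * \<phi> ^ j * D) x = 0"
        using x by (simp only: kills_def)
      then show ?thesis using y(2) by (simp add: B_simps B_act_d_d)
    qed
    moreover have "?y \<in> U" using y(1) by (intro subspace_add subspace_scale subspace_U act_U d_U)
    ultimately show ?case unfolding t(2) by blast
  qed
  from this[of "Suc l"] show ?thesis by simp
qed

text \<open>Starting from \<open>\<phi> ^ Suc l\<close>, the powers of \<open>\<phi>\<close> are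
  stripped off one by one: a factor \<open>\<phi>\<close> may be replaced by its multiple
  \<open>D\<close>, and the second assumption removes \<open>D\<close>.\<close>

lemma kills_descent:
  assumes "D = \<phi> * b" "\<And>e. kills (e * t * D) \<Longrightarrow> kills (e * t)"
  shows "kills t"
proof -
  have "kills (\<phi> ^ n * t) \<Longrightarrow> kills t" for n
  proof (induction n)
    case (Suc n)
    have "kills (\<phi> ^ n * t * D)"
      using kills_mult[OF Suc.prems, of b] by (simp add: assms(1) mult_ac)
    then show ?case using assms(2) Suc.IH by blast
  qed simp
  then show ?thesis using kills_mult[OF kills_power[of "Suc l"]] by blast
qed

text \<open>The space generated by \<open>x\<close> and \<open>y\<close> is nondegenerate: pairing
  an element of its radical with the four kinds of generators gives \<open>E1\<close> to
  \<open>E4\<close>. These yield the cycles from \<open>t * D\<close> to \<open>p\<close> to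
  \<open>t\<close> and from \<open>q * D\<close> to \<open>r\<close> to \<open>q\<close>, to which
  \<open>kills_descent\<close> applies.\<close>

lemma reversible_pair:
  assumes x: "x \<in> U" and y: "y \<in> U" "B (poly_act (\<phi> ^ l) (d x)) y \<noteq> 0"
    and xy: "\<And>s. B (poly_act s x) y = 0" and D: "D = \<phi> * b"
  shows "reversible U"
proof -
  let ?W = "cyclic_pair x y"
  have yx: "B y (poly_act s x) = 0" "B (poly_act s y) x = 0" for s
    using xy by (metis B_sym, metis B_act B_sym xy)
  have nd: "nondegenerate_on ?W"
    unfolding nondegenerate_on_def
  proof (intro ballI impI)
    fix z assume z: "z \<in> ?W" "\<forall>v\<in>?W. B z v = 0"
    obtain p q r t where pq: "z = poly_act p x + poly_act q (d x) + poly_act r y + poly_act t (d y)"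
      using z(1) by (elim cyclic_pairE) simp
    have self: "B (poly_act p (d u)) (poly_act q u) = 0" for p q u
      using B_act_d B_sym by metis
    have B0: "B z (poly_act s x) = 0" "B z (poly_act s (d x)) = 0"
      "B z (poly_act s y) = 0" "B z (poly_act s (d y)) = 0" for s
      using z(2) mem_cyclic_pair by blast+
    have dy: "B (poly_act p (d y)) (poly_act q x) = - B (poly_act (p * q) (d x)) y" for p q
      by (subst B_sym) (simp add: B_act_d_right mult.commute)
    have dxdy: "B (poly_act p (d x)) (poly_act q (d y)) = 0" "B (poly_act p (d y)) (poly_act q (d x)) = 0" for p q
      by (simp_all add: B_act_d_d xy yx)
    have dydx: "B (poly_act p y) (poly_act q (d x)) = B (poly_act (p * q) (d x)) y" for p q
      by (subst B_sym) (simp add: B_act_act mult.commute)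
    have E1: "B (poly_act (t * s) (d x)) y = B (poly_act (p * s) x) x" for s
    proof -
      have "B z (poly_act s x) = B (poly_act (p * s) x) x + 0 + 0 - B (poly_act (t * s) (d x)) y"
        by (simp only: pq B_add self dy) (simp add: B_act_act yx)
      then show ?thesis using B0(1)[of s] by simp
    qed
    have E2: "B (poly_act (r * s) (d x)) y = B (poly_act (q * D * s) x) x" for s
    proof -
      have "B z (poly_act s (d x)) = 0 - B (poly_act (q * D * s) x) x + B (poly_act (r * s) (d x)) y + 0"
        by (simp only: pq B_add dydx dxdy B_act_d B_act_d_d[of q x s x]) (simp add: mult_ac)
      then show ?thesis using B0(2)[of s] by simp
    qed
    have E3: "B (poly_act (q * s) (d x)) y = - B (poly_act (r * s) y) y" for s
    proof -
      have "B z (poly_act s y) = 0 + B (poly_act (q * s) (d x)) y + B (poly_act (r * s) y) y + 0"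
        by (simp only: pq B_add self) (simp add: B_act_act xy)
      then show ?thesis using B0(3)[of s] by (simp add: eq_neg_iff_add_eq_0)
    qed
    have E4: "B (poly_act (p * s) (d x)) y = - B (poly_act (t * D * s) y) y" for s
    proof -
      have "B z (poly_act s (d y)) = - B (poly_act (p * s) (d x)) y + 0 + 0 - B (poly_act (t * D * s) y) y"
        by (simp only: pq B_add dxdy B_act_d B_act_d_d[of t y s y] B_act_d_right[of p x s y]) (simp add: mult_ac)
      then have "- B (poly_act (p * s) (d x)) y = B (poly_act (t * D * s) y) y"
        using B0(4)[of s] by simp
      then show ?thesis by (metis minus_minus)
    qed
    have k: "kills p" if "\<And>s. B (poly_act (p * s) (d x)) y = 0" for p
      using kills_if_functional_vanishes[OF d_U[OF x] y(2)] that by blast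
    \<comment> \<open>The factor \<open>e\<close> in \<open>H1\<close> to \<open>H4\<close> carries
      the powers of \<open>\<phi>\<close> that \<open>kills_descent\<close> strips off.\<close>
    have H1: "kills (e * p)" if "kills (e * t * D)" for e
    proof (rule k)
      fix s
      have "B (poly_act (p * (e * s)) (d x)) y = 0"
        unfolding E4 using kills_mult[OF that, of s] y(1) by (simp add: kills_def mult_ac)
      then show "B (poly_act (e * p * s) (d x)) y = 0" by (simp add: mult_ac)
    qed
    have H2: "kills (e * t)" if "kills (e * p)" for e
    proof (rule k)
      fix s
      have "B (poly_act (t * (e * s)) (d x)) y = 0"
        unfolding E1 using kills_mult[OF that, of s] x by (simp add: kills_def mult_ac)
      then show "B (poly_act (e * t * s) (d x)) y = 0" by (simp add: mult_ac)
    qed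
    have H3: "kills (e * r)" if "kills (e * q * D)" for e
    proof (rule k)
      fix s
      have "B (poly_act (r * (e * s)) (d x)) y = 0"
        unfolding E2 using kills_mult[OF that, of s] x by (simp add: kills_def mult_ac)
      then show "B (poly_act (e * r * s) (d x)) y = 0" by (simp add: mult_ac)
    qed
    have H4: "kills (e * q)" if "kills (e * r)" for e
    proof (rule k)
      fix s
      have "B (poly_act (q * (e * s)) (d x)) y = 0"
        unfolding E3 using kills_mult[OF that, of s] y(1) by (simp add: kills_def mult_ac)
      then show "B (poly_act (e * q * s) (d x)) y = 0" by (simp add: mult_ac)
    qed
    have "kills t" by (rule kills_descent[OF D]) (rule H2, rule H1)
    moreover have "kills q" by (rule kills_descent[OF D]) (rule H4, rule H3)
    moreover have "kills p" using H1[of 1] kills_mult[OF \<open>kills t\<close>] by simp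
    moreover have "kills r" using H3[of 1] kills_mult[OF \<open>kills q\<close>] by simp
    ultimately show "z = 0" using x y(1) d_U by (simp add: pq kills_def)
  qed
  have "x \<in> ?W" using mem_cyclic_pair(1)[of 1 x y] by simp
  moreover have "x \<noteq> 0" using y(2) by auto
  moreover have "?W \<subseteq> U" using cyclic_pair_subset U_stable x y(1) by blast
  ultimately have "?W = U" using indecomposable[OF _ stable_cyclic_pair nd] by blast
  then show ?thesis using reversible_cyclic_pair[OF nd xy] by simp
qed

text \<open>One generator is enough unless \<open>\<phi>\<close> divides \<open>D\<close> and
  \<open>\<phi> ^ l\<close> acts nontrivially on the image of \<open>d\<close>. In that case a
  vector pairing nontrivially with \<phi>^l d x is corrected to a second generator.\<close>

lemma reversible_indecomposable: "reversible U"
proof (cases "invp D \<or> (\<forall>u\<in>U. poly_act (\<phi> ^ l) (d u) = 0)")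
  case True
  then show ?thesis using ex_anisotropic reversible_if_anisotropic D_cases by blast
next
  case False
  then obtain b where b: "D = \<phi> * b" using D_cases by blast
  obtain x where x: "x \<in> U" "poly_act (\<phi> ^ l) (d x) \<noteq> 0" using False by blast
  obtain y0 where y0: "y0 \<in> U" "B (poly_act (\<phi> ^ l) (d x)) y0 \<noteq> 0"
    using nondeg_witness[OF act_U[OF d_U[OF x(1)]] x(2)] by blast
  then show ?thesis
    using ex_orthogonal_partner[OF x(1) y0 b] reversible_pair[OF x(1) _ _ _ b] by blast
qed

end

section \<open>Wonenburger's theorem for arbitrary nondegenerate finite spaces\<close>

context isometry
begin

text \<open>Induction on the number of elements: a nonzero proper stable nondegenerate
  \<open>W\<close> and its complement in \<open>U\<close> are both smaller and inherit the
  assumptions.\<close>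

theorem reversible_if_nondegenerate:
  assumes "finite U" "stable U" "nondegenerate_on U"
  shows "reversible U"
  using assms
proof (induction "card U" arbitrary: U rule: less_induct)
  case less
  have sU: "subspace U" using less.prems(2) by (simp add: stable_def)
  show ?case
  proof (cases "U = {0}")
    case True
    then show ?thesis
      unfolding reversible_def isometry_on_def by (intro exI[of _ id]) auto
  next
    case nz: False
    show ?thesis
    proof (cases "\<exists>W. W \<subseteq> U \<and> stable W \<and> nondegenerate_on W \<and> W \<noteq> {0} \<and> W \<noteq> U")
      case True
      then obtain W where W: "W \<subseteq> U" "stable W" "nondegenerate_on W" "W \<noteq> {0}" "W \<noteq> U" by blast
      have finW: "finite W" using W(1) less.prems(1) finite_subset by blast
      have sW: "subspace W" using W(2) by (simp add: stable_def)
      let ?W' = "{u\<in>U. \<forall>w\<in>W. B u w = 0}"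
      have "card W < card U" using W less.prems(1) by (intro psubset_card_mono) auto
      then have "reversible W" using less.hyps finW W by blast
      moreover have "reversible ?W'"
      proof (rule less.hyps)
        obtain w where w: "w \<in> W" "w \<noteq> 0" using W(4) subspace_0[OF sW] by blast
        then have "w \<notin> ?W'" using W(3) by (auto simp: nondegenerate_on_def)
        then have "?W' \<subset> U" using w W(1) by blast
        then show "card ?W' < card U" using less.prems(1) by (intro psubset_card_mono)
        show "finite ?W'" using less.prems(1) by simp
        show "stable ?W'"
          using less.prems(2) W(2) sU
          by (auto simp: stable_def subspace_def B_simps B_g_left B_g'_left)
        show "nondegenerate_on ?W'"
          unfolding nondegenerate_on_def
        proof (intro ballI impI)
          fix u assume u: "u \<in> ?W'" "\<forall>v\<in>?W'. B u v = 0"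
          have "B u v = 0" if "v \<in> U" for v
          proof -
            obtain w where w: "w \<in> W" "\<forall>v'\<in>W. B (v - w) v' = 0"
              using orthogonal_projection[OF finW sW W(3)] by blast
            then have "v - w \<in> ?W'" using that W(1) subspace_diff[OF sU] by blast
            then have "B u (v - w) = 0" using u(2) by blast
            then show ?thesis using u(1) w(1) by (simp add: B_simps)
          qed
          then show "u = 0" using less.prems(3) u(1) by (auto simp: nondegenerate_on_def)
        qed
      qed
      ultimately show ?thesis
        using reversible_orthogonal_sum[OF less.prems(2) W(2,1) finW W(3)] by blast
    next
      case False
      then interpret indecomposable_isometry scale B g g' U
        using less.prems nz by unfold_locales auto
      show ?thesis by (rule reversible_indecomposable)
    qed
  qed
qed

end

section \<open>Irreducible representations of finite groups\<close>

context finite_dimensional_vector_space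
begin

abbreviation coord :: "'b \<Rightarrow> 'b \<Rightarrow> 'a" where
  "coord v b \<equiv> representation Basis v b"

lemma coord_simps: "coord (u + v) b = coord u b + coord v b" "coord (scale c v) b = c * coord v b"
  "coord 0 b = 0"
  by (simp_all add: representation_add representation_scale representation_zero independent_Basis span_Basis)

lemma sum_coord: "(\<Sum>b\<in>Basis. scale (coord v b) b) = v"
  by (rule sum_representation_eq) (auto simp: independent_Basis span_Basis finite_Basis)

definition trace :: "('b \<Rightarrow> 'b) \<Rightarrow> 'a" where
  "trace A = (\<Sum>b\<in>Basis. coord (A b) b)"

lemma trace_add: "trace (\<lambda>v. A v + C v) = trace A + trace C"
  by (simp add: trace_def coord_simps sum.distrib)

lemma trace_scale: "trace (\<lambda>v. scale c (A v)) = c * trace A"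
  by (simp add: trace_def coord_simps sum_distrib_left)

lemma trace_zero: "trace (\<lambda>v. 0) = 0"
  by (simp add: trace_def coord_simps)

lemma coord_sum: "coord (sum f I) b = (\<Sum>i\<in>I. coord (f i) b)"
  by (induction I rule: infinite_finite_induct) (auto simp: coord_simps)

lemma coord_linear:
  assumes "vector_endomorphism scale A"
  shows "coord (A v) b = (\<Sum>b'\<in>Basis. coord v b' * coord (A b') b)"
proof -
  have "A v = A (\<Sum>b\<in>Basis. scale (coord v b) b)" by (simp only: sum_coord)
  also have "\<dots> = (\<Sum>b'\<in>Basis. scale (coord v b') (A b'))"
    using assms by (simp add: vector_endomorphism.f_sum vector_endomorphism.f_scale)
  finally show ?thesis by (simp add: coord_sum coord_simps)
qed

lemma trace_commute:
  assumes "vector_endomorphism scale A" "vector_endomorphism scale C"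
  shows "trace (A \<circ> C) = trace (C \<circ> A)"
proof -
  have "trace (A \<circ> C) = (\<Sum>b\<in>Basis. \<Sum>b'\<in>Basis. coord (C b) b' * coord (A b') b)"
    by (simp add: trace_def coord_linear[OF assms(1), of "C _"])
  also have "\<dots> = (\<Sum>b'\<in>Basis. \<Sum>b\<in>Basis. coord (A b') b * coord (C b) b')"
    by (subst sum.swap) (simp add: mult.commute)
  also have "\<dots> = trace (C \<circ> A)"
    by (simp add: trace_def coord_linear[OF assms(2), of "A _"])
  finally show ?thesis .
qed

text \<open>Turns traces against rank one operators into values of a functional; this is how
  nondegeneracy of the trace form is exploited.\<close>

lemma trace_rank_one:
  assumes "vector_endomorphism scale X" and f: "\<And>u v. f (u + v) = f u + f v" "\<And>c v. f (scale c v) = c * f v"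
  shows "trace (X \<circ> (\<lambda>v. scale (f v) w)) = f (X w)"
proof -
  have f0: "f 0 = 0" using f(2)[of 0 0] by simp
  have fs: "f (sum h I) = (\<Sum>i\<in>I. f (h i))" for h and I :: "'b set"
    by (induction I rule: infinite_finite_induct) (auto simp: f f0)
  have "trace (X \<circ> (\<lambda>v. scale (f v) w)) = (\<Sum>b\<in>Basis. f b * coord (X w) b)"
    using assms(1) by (simp add: trace_def vector_endomorphism.f_scale coord_simps)
  also have "\<dots> = f (\<Sum>b\<in>Basis. scale (coord (X w) b) b)"
    by (simp add: fs f mult.commute)
  finally show ?thesis by (simp only: sum_coord)
qed

end

text \<open>The iterates of \<open>w\<close> from exponent 0 to the dimension are one too many to be
  independent.\<close>

lemma (in finite_dimensional_vector_space) annihilating_polynomial: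
  assumes "vector_endomorphism scale f"
  shows "\<exists>p. p \<noteq> 0 \<and> vector_endomorphism.poly_act scale f p w = 0"
proof -
  interpret vector_endomorphism scale f by fact
  let ?N = "card Basis"
  let ?h = "\<lambda>i. (f ^^ i) w"
  show ?thesis
  \<comment> \<open>Dependence is a notion for sets, so coinciding iterates have to be treated
    separately.\<close>
  proof (cases "inj_on ?h {..?N}")
    case False
    then obtain i j where ij: "i \<noteq> j" "?h i = ?h j" by (auto simp: inj_on_def)
    have "coeff (monom (1::'a) i - monom 1 j) i \<noteq> 0" using ij(1) by simp
    then have "monom (1::'a) i - monom 1 j \<noteq> 0" by (metis coeff_0)
    moreover have "poly_act (monom 1 i - monom 1 j) w = 0"
      using ij(2) by (simp add: act.scale_left_diff_distrib poly_act_monom)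
    ultimately show ?thesis by blast
  next
    case True
    let ?S = "?h ` {..?N}"
    have "card ?S = Suc ?N" using True by (simp add: card_image)
    moreover have "card ?S \<le> ?N" if "independent ?S"
      using independent_span_bound[OF finite_Basis that] by (auto simp: span_Basis)
    ultimately have "dependent ?S" by fastforce
    then obtain c where c: "\<exists>v\<in>?S. c v \<noteq> 0" "(\<Sum>v\<in>?S. scale (c v) v) = 0"
      using dependent_finite[of ?S] by auto
    define p where "p = (\<Sum>i\<le>?N. monom (c (?h i)) i)"
    have "poly_act p w = (\<Sum>i\<le>?N. scale (c (?h i)) (?h i))"
      by (simp add: p_def act.scale_sum_left poly_act_monom)
    also have "\<dots> = 0" using c(2) by (subst (asm) sum.reindex[OF True]) simp
    finally have "poly_act p w = 0" .
    moreover have "p \<noteq> 0"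
    proof -
      obtain i where i: "i \<le> ?N" "c (?h i) \<noteq> 0" using c(1) by auto
      have "coeff p i = (\<Sum>j\<le>?N. if j = i then c (?h j) else 0)"
        unfolding p_def coeff_sum by (rule sum.cong) auto
      also have "\<dots> = c (?h i)" using i(1) by (subst sum.delta) auto
      finally have "coeff p i \<noteq> 0" using i(2) by simp
      then show ?thesis by (metis coeff_0)
    qed
    ultimately show ?thesis by blast
  qed
qed

text \<open>Split a linear factor off an annihilating polynomial of \<open>w\<close> of least
  degree: the cofactor sends \<open>w\<close> to an eigenvector, which lies in \<open>R\<close> by
  invariance.\<close>

lemma ex_eigenvector:
  fixes scale :: "'k::alg_closed_field \<Rightarrow> 'v::ab_group_add \<Rightarrow> 'v"
  assumes "finite_dimensional_vector_space scale Basis" "vector_endomorphism scale f"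
    and R: "module.subspace scale R" "\<And>v. v \<in> R \<Longrightarrow> f v \<in> R" and w: "w \<in> R" "w \<noteq> 0"
  shows "\<exists>c v. v \<in> R \<and> v \<noteq> 0 \<and> f v = scale c v"
proof -
  interpret finite_dimensional_vector_space scale Basis by fact
  interpret vector_endomorphism scale f by fact
  obtain p0 where "p0 \<noteq> 0 \<and> poly_act p0 w = 0"
    using annihilating_polynomial[OF assms(2)] by blast
  from ex_has_least_nat[of "\<lambda>p. p \<noteq> 0 \<and> poly_act p w = 0", OF this, of degree]
  obtain p where p: "p \<noteq> 0" "poly_act p w = 0"
    "\<And>q. q \<noteq> 0 \<Longrightarrow> poly_act q w = 0 \<Longrightarrow> degree p \<le> degree q" by auto
  have "degree p > 0"
  proof (rule ccontr)
    assume "\<not> degree p > 0"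
    then obtain a where "p = [:a:]" by (auto elim: degree_eq_zeroE)
    then show False using p(1,2) w(2) by (simp add: scale_eq_0_iff)
  qed
  then obtain c where "poly p c = 0" using alg_closed_imp_poly_has_root by blast
  then obtain q where q: "p = [:-c, 1:] * q" by (auto simp: poly_eq_0_iff_dvd)
  have "q \<noteq> 0" using q p(1) by auto
  then have "degree p = Suc (degree q)" unfolding q by (subst degree_mult_eq) auto
  then have nz: "poly_act q w \<noteq> 0" using p(3)[OF \<open>q \<noteq> 0\<close>] by auto
  have "poly_act [:-c, 1:] (poly_act q w) = 0" using p(2) by (simp only: q poly_act_mult)
  then have "f (poly_act q w) = scale c (poly_act q w)" by simp
  moreover have "poly_act q w \<in> R" using R w(1) by (intro poly_act_in_subspace)
  ultimately show ?thesis using nz by blast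
qed

text \<open>Relates the operator of an element of the group algebra to the operator of its image under
  inversion of group elements. Only a relation, since the representation may fail to be faithful on the
  group algebra.\<close>

inductive dual_pair :: "('g, 'm) monoid_scheme \<Rightarrow> ('k::field \<Rightarrow> 'v::ab_group_add \<Rightarrow> 'v) \<Rightarrow> ('g \<Rightarrow> 'v \<Rightarrow> 'v)
    \<Rightarrow> ('v \<Rightarrow> 'v) \<Rightarrow> ('v \<Rightarrow> 'v) \<Rightarrow> bool"
  for G scale \<pi> where
  base: "g \<in> carrier G \<Longrightarrow> dual_pair G scale \<pi> (\<pi> g) (\<pi> (inv\<^bsub>G\<^esub> g))"
| add: "dual_pair G scale \<pi> A A' \<Longrightarrow> dual_pair G scale \<pi> C C' \<Longrightarrow>
    dual_pair G scale \<pi> (\<lambda>v. A v + C v) (\<lambda>v. A' v + C' v)"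
| scale: "dual_pair G scale \<pi> A A' \<Longrightarrow> dual_pair G scale \<pi> (\<lambda>v. scale c (A v)) (\<lambda>v. scale c (A' v))"

section \<open>Operators spanned by the group, and their duals\<close>

locale irreducible_rep = vector_space scale + group G
  for scale :: "'k::alg_closed_field \<Rightarrow> 'v::ab_group_add \<Rightarrow> 'v" and G :: "('g, 'm) monoid_scheme" (structure) +
  fixes \<pi> :: "'g \<Rightarrow> 'v \<Rightarrow> 'v"
  assumes finite_G: "finite (carrier G)" and irreducible: "irreducible_representation G scale \<pi>"
begin

abbreviation dp where "dp \<equiv> dual_pair G scale \<pi>"

lemma \<pi>_linear: "g \<in> carrier G \<Longrightarrow> vector_endomorphism scale (\<pi> g)"
  using irreducible vector_space_axioms
  by (auto simp: irreducible_representation_def Defs.representation_def linear_iff_module_hom module_hom_iff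
      vector_endomorphism_def vector_endomorphism_axioms_def)

lemma \<pi>_one: "\<pi> \<one> v = v" and \<pi>_mult: "g \<in> carrier G \<Longrightarrow> h \<in> carrier G \<Longrightarrow> \<pi> (g \<otimes> h) v = \<pi> g (\<pi> h v)"
  using irreducible by (auto simp: irreducible_representation_def Defs.representation_def)

lemma dp_linear:
  assumes "dp A A'"
  shows "vector_endomorphism scale A" "vector_endomorphism scale A'"
  using assms
proof (induction)
  case (base g)
  { case 1 show ?case using base by (rule \<pi>_linear) next
    case 2 show ?case using base by (intro \<pi>_linear) simp }
next
  case (add A A' C C')
  note f = add.IH[THEN vector_endomorphism.f_add] add.IH[THEN vector_endomorphism.f_scale]
  { case 1 show ?case by unfold_locales (simp_all add: f scale_right_distrib) next
    case 2 show ?case by unfold_locales (simp_all add: f scale_right_distrib) }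
next
  case (scale A A' c)
  note f = scale.IH[THEN vector_endomorphism.f_add] scale.IH[THEN vector_endomorphism.f_scale]
  { case 1 show ?case by unfold_locales (simp_all add: f scale_right_distrib mult.commute) next
    case 2 show ?case by unfold_locales (simp_all add: f scale_right_distrib mult.commute) }
qed

lemmas dp_add = dp_linear(1)[THEN vector_endomorphism.f_add] dp_linear(2)[THEN vector_endomorphism.f_add]
lemmas dp_scale = dp_linear(1)[THEN vector_endomorphism.f_scale] dp_linear(2)[THEN vector_endomorphism.f_scale]

lemma dp_sym: "dp A A' \<Longrightarrow> dp A' A"
proof (induction rule: dual_pair.induct)
  case (base g)
  then show ?case using dual_pair.base[of "inv g" G scale \<pi>] by simp
qed (auto intro: dual_pair.intros)

lemma dp_id: "dp (\<lambda>v. v) (\<lambda>v. v)"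
proof -
  have "\<pi> \<one> = (\<lambda>v. v)" using \<pi>_one by blast
  then show ?thesis using dual_pair.base[of \<one> G scale \<pi>] by simp
qed

lemma dp_zero: "dp (\<lambda>v. 0) (\<lambda>v. 0)"
  using dual_pair.scale[OF dp_id, of 0] by simp

lemma dp_diff: "dp A A' \<Longrightarrow> dp C C' \<Longrightarrow> dp (\<lambda>v. A v - C v) (\<lambda>v. A' v - C' v)"
  using dual_pair.add[of G scale \<pi> A A' "\<lambda>v. scale (-1) (C v)" "\<lambda>v. scale (-1) (C' v)"]
    dual_pair.scale[of G scale \<pi> C C' "-1"] by simp

text \<open>The order of the dual factors is reversed because inversion is an anti-automorphism of
  the group.\<close>

lemma dp_comp:
  assumes "dp A A'" "dp C C'"
  shows "dp (\<lambda>v. A (C v)) (\<lambda>v. C' (A' v))"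
  using assms(1)
proof (induction rule: dual_pair.induct)
  case (base g)
  show ?case
    using assms(2)
  proof (induction rule: dual_pair.induct)
    case (base h)
    have "\<pi> (g \<otimes> h) = (\<lambda>v. \<pi> g (\<pi> h v))"
      using base \<open>g \<in> carrier G\<close> by (auto simp: \<pi>_mult)
    moreover have "\<pi> (inv (g \<otimes> h)) = (\<lambda>v. \<pi> (inv h) (\<pi> (inv g) v))"
      using base \<open>g \<in> carrier G\<close> by (auto simp: \<pi>_mult inv_mult_group)
    ultimately show ?case
      using dual_pair.base[of "g \<otimes> h" G scale \<pi>] base \<open>g \<in> carrier G\<close> by simp
  next
    case (add C C' E E')
    then show ?case
      using dual_pair.add[OF add.IH] vector_endomorphism.f_add[OF \<pi>_linear[OF base]] by simp
  next
    case (scale C C' c)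
    then show ?case
      using dual_pair.scale[OF scale.IH] vector_endomorphism.f_scale[OF \<pi>_linear[OF base]] by simp
  qed
next
  case (add A A' E E')
  then show ?case
    using dual_pair.add[OF add.IH] dp_add(2)[OF assms(2)] by simp
next
  case (scale A A' c)
  then show ?case
    using dual_pair.scale[OF scale.IH] dp_scale(2)[OF assms(2)] by simp
qed

lemma invariant_subspace:
  assumes "subspace W" "\<And>g v. g \<in> carrier G \<Longrightarrow> v \<in> W \<Longrightarrow> \<pi> g v \<in> W"
  shows "W = {0} \<or> W = UNIV"
  using irreducible assms unfolding irreducible_representation_def by blast

text \<open>The vectors \<open>A x\<close> form an invariant subspace containing \<open>x\<close>,
  hence everything by irreducibility.\<close>

lemma dp_transitive:
  assumes "x \<noteq> 0"
  shows "\<exists>A A'. dp A A' \<and> A x = y"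
proof -
  let ?W = "{A x | A A'. dp A A'}"
  have "subspace ?W"
    unfolding subspace_def
  proof (intro conjI ballI allI)
    show "0 \<in> ?W" using dp_zero by force
    show "u + v \<in> ?W" if "u \<in> ?W" "v \<in> ?W" for u v using that dual_pair.add by fastforce
    show "scale c u \<in> ?W" if "u \<in> ?W" for c u using that dual_pair.scale by fastforce
  qed
  moreover have "\<pi> g v \<in> ?W" if "g \<in> carrier G" "v \<in> ?W" for g v
    using dp_comp[OF dual_pair.base[OF that(1), of scale \<pi>]] that(2) by fastforce
  ultimately have "?W = {0} \<or> ?W = UNIV" by (rule invariant_subspace)
  moreover have "x \<in> ?W" using dp_id by force
  ultimately have "y \<in> ?W" using assms by auto
  then show ?thesis by auto
qed

text \<open>A nonzero \<open>x\<close> is carried to \<open>v0\<close> by some operator. The scalar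
  action \<open>s\<close> on the target allows \<open>f\<close> to be a functional or an
  operator.\<close>

lemma separating:
  assumes f: "\<And>u v. f (u + v) = f u + f v" "\<And>c v. f (scale c v) = s c (f v)"
    and s: "\<And>c. s c 0 = 0" and nz: "f v0 \<noteq> (0 :: 'z::ab_group_add)"
    and x: "\<And>A A'. dp A A' \<Longrightarrow> f (A x) = 0"
  shows "x = 0"
proof (rule ccontr)
  assume "x \<noteq> 0"
  then obtain A A' where "dp A A'" "A x = v0" using dp_transitive by blast
  then show False using x nz by blast
qed

text \<open>The finite orbit of one nonzero vector spans the space.\<close>

lemma finite_dimensional: "\<exists>Basis. finite_dimensional_vector_space scale Basis"
proof -
  obtain v0 :: 'v where v0: "v0 \<noteq> 0"
    using irreducible unfolding irreducible_representation_def by auto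
  let ?S = "(\<lambda>g. \<pi> g v0) ` carrier G"
  have "A v0 \<in> span ?S" if "dp A A'" for A A'
    using that by (induction rule: dual_pair.induct) (auto intro: span_base span_add span_scale)
  then have S: "span ?S = UNIV" using dp_transitive[OF v0] by (metis UNIV_eq_I)
  obtain Basis where B: "independent Basis" "UNIV \<subseteq> span Basis"
    using maximal_independent_subset[of UNIV] by blast
  have "finite Basis" using independent_span_bound[OF _ B(1), of ?S] S finite_G by auto
  then have "finite_dimensional_vector_space scale Basis" using B by unfold_locales auto
  then show ?thesis ..
qed

text \<open>An operator \<open>T\<close> with maximal kernel works: otherwise \<open>T \<circ> A\<close>, for a suitable \<open>A\<close>, has an eigenvalue \<open>c\<close>
  on the range of \<open>T\<close>, and \<open>T \<circ> A \<circ> T - c T\<close> is nonzero with a larger kernel.\<close>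

lemma ex_rank_one:
  "\<exists>T T' u f. dp T T' \<and> u \<noteq> 0 \<and> (\<forall>v. T v = scale (f v) u) \<and> (\<exists>v. f v \<noteq> 0)
     \<and> (\<forall>v w. f (v + w) = f v + f w) \<and> (\<forall>c v. f (scale c v) = c * f v)"
proof -
  obtain Basis where "finite_dimensional_vector_space scale Basis" using finite_dimensional ..
  then interpret finite_dimensional_vector_space scale Basis .
  let ?P = "\<lambda>T. (\<exists>T'. dp T T') \<and> (\<exists>v. T v \<noteq> 0)"
  obtain v0 :: 'v where v0: "v0 \<noteq> 0"
    using irreducible unfolding irreducible_representation_def by auto
  have "?P (\<lambda>v. v)" using dp_id v0 by blast
  moreover have "\<forall>T. ?P T \<longrightarrow> dim {v. T v = 0} < Suc dimension"
    using dim_subset_UNIV by (simp add: less_Suc_eq_le)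
  ultimately have "\<exists>T. ?P T \<and> (\<forall>S. ?P S \<longrightarrow> dim {v. S v = 0} \<le> dim {v. T v = 0})"
    by (rule ex_has_greatest_nat)
  then obtain T T' x1 where T: "dp T T'" "T x1 \<noteq> 0"
    and max: "\<And>S S' v. dp S S' \<Longrightarrow> S v \<noteq> 0 \<Longrightarrow> dim {v. S v = 0} \<le> dim {v. T v = 0}" by blast
  have sub_ker: "subspace {v. S v = 0}" if "dp S S'" for S S'
    using dp_add(1)[OF that] dp_scale(1)[OF that] vector_endomorphism.f_zero[OF dp_linear(1)[OF that]]
    by (simp add: subspace_def)
  have line: "\<exists>c. T x = scale c (T x1)" for x
  proof (rule ccontr)
    assume x: "\<nexists>c. T x = scale c (T x1)"
    obtain A A' where A: "dp A A'" "A (T x1) = x" using dp_transitive[OF T(2)] by blast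
    have M: "dp (\<lambda>v. T (A v)) (\<lambda>v. A' (T' v))" using dp_comp[OF T(1) A(1)] .
    have "subspace (range T)"
      using dp_add(1)[OF T(1), symmetric] dp_scale(1)[OF T(1), symmetric]
        vector_endomorphism.f_zero[OF dp_linear(1)[OF T(1)]]
      by (auto simp: subspace_def image_iff)
    then obtain c w where w: "w \<in> range T" "w \<noteq> 0" "T (A w) = scale c w"
      using ex_eigenvector[OF finite_dimensional_vector_space_axioms dp_linear(1)[OF M], of "range T" "T x1"] T(2)
      by blast
    then obtain y where y: "w = T y" by blast
    let ?S = "\<lambda>v. T (A (T v)) - scale c (T v)"
    have S: "dp ?S (\<lambda>v. T' (A' (T' v)) - scale c (T' v))"
      by (rule dp_diff[OF dp_comp[OF M T(1)] dual_pair.scale[OF T(1)]])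
    have "?S x1 \<noteq> 0" using x A(2) by auto
    then have "dim {v. ?S v = 0} \<le> dim {v. T v = 0}" by (rule max[OF S])
    moreover have "{v. T v = 0} \<subseteq> {v. ?S v = 0}"
      using vector_endomorphism.f_zero[OF dp_linear(1)[OF M]] by auto
    ultimately have "{v. T v = 0} = {v. ?S v = 0}"
      using sub_ker[OF T(1)] sub_ker[OF S] subspace_dim_equal by blast
    moreover have "?S y = 0" using w(3) y by simp
    ultimately show False using w(2) y by blast
  qed
  then obtain f where f: "\<And>x. T x = scale (f x) (T x1)" by metis
  have inj: "a = b" if "scale a (T x1) = scale b (T x1)" for a b
    using that T(2) by (simp add: scale_cancel_right)
  have "f (v + w) = f v + f w" for v w
    by (rule inj) (metis dp_add(1)[OF T(1)] f scale_left_distrib)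
  moreover have "f (scale c v) = c * f v" for c v
    by (rule inj) (metis dp_scale(1)[OF T(1)] f scale_scale)
  moreover have "f x1 \<noteq> 0" using f[of x1] T(2) by auto
  ultimately show ?thesis using T f by blast
qed

text \<open>Uses that the trace form on the operators spanned by the group is nondegenerate.\<close>

lemma dp_zero_left:
  assumes conj: "\<forall>g\<in>carrier G. \<exists>x\<in>carrier G. x \<otimes> g \<otimes> inv x = inv g"
    and "dp A A'" "\<And>v. A v = 0"
  shows "A' v = 0"
proof -
  obtain Basis where "finite_dimensional_vector_space scale Basis" using finite_dimensional ..
  then interpret finite_dimensional_vector_space scale Basis .
  \<comment> \<open>On group elements this holds because \<open>g\<close> and its inverse are
    conjugate; both sides are linear.\<close>
  have tr: "trace A = trace A'" if "dp A A'" for A A'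
    using that
  proof (induction rule: dual_pair.induct)
    case (base g)
    then obtain x where x: "x \<in> carrier G" "x \<otimes> g \<otimes> inv x = inv g" using conj by blast
    have gx: "g \<otimes> inv x \<in> carrier G" using x(1) base by simp
    have 1: "\<pi> (inv g) = (\<pi> x \<circ> \<pi> (g \<otimes> inv x))"
      using x base by (auto simp: \<pi>_mult[symmetric] m_assoc simp flip: x(2))
    have 2: "\<pi> g = \<pi> (g \<otimes> inv x) \<circ> \<pi> x"
      using x base by (auto simp: \<pi>_mult[symmetric] m_assoc)
    have "trace (\<pi> g) = trace (\<pi> (g \<otimes> inv x) \<circ> \<pi> x)" by (rule arg_cong[OF 2])
    also have "\<dots> = trace (\<pi> x \<circ> \<pi> (g \<otimes> inv x))"
      using x(1) gx by (intro trace_commute \<pi>_linear)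
    also have "\<dots> = trace (\<pi> (inv g))" by (rule arg_cong[OF 1[symmetric]])
    finally show ?case .
  qed (simp_all add: trace_add trace_scale)
  obtain T T' u f where T: "dp T T'" "u \<noteq> 0" "\<And>v. T v = scale (f v) u" and nz: "\<exists>v. f v \<noteq> 0"
    and f: "\<And>v w. f (v + w) = f v + f w" "\<And>c v. f (scale c v) = c * f v"
    using ex_rank_one by blast
  \<comment> \<open>The trace of A' E T C equals that of its dual C' T' E' A, which is zero. The
    rank one formula evaluates it as f(C A' E u), with \<open>C\<close> and \<open>E\<close>
    arbitrary.\<close>
  have z: "f (C (A' (E u))) = 0" if C: "dp C C'" and E: "dp E E'" for C C' E E'
  proof -
    have EC: "dp (\<lambda>v. E (T (C v))) (\<lambda>v. C' (T' (E' v)))"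
      using dp_comp[OF E dp_comp[OF T(1) C]] .
    have "trace (\<lambda>v. A' (E (T (C v)))) = trace (\<lambda>v. C' (T' (E' (A v))))"
      using tr[OF dp_comp[OF dp_sym[OF assms(2)] EC]] .
    also have "\<dots> = 0"
      using vector_endomorphism.f_zero[OF dp_linear(2)[OF EC]] by (simp add: assms(3) trace_zero)
    also have "(\<lambda>v. A' (E (T (C v)))) = A' \<circ> (\<lambda>v. scale (f (C v)) (E u))"
      by (auto simp: T(3) dp_scale(1)[OF E])
    also have "trace \<dots> = f (C (A' (E u)))"
      using dp_linear(2)[OF assms(2)] by (rule trace_rank_one) (simp_all add: dp_add(1)[OF C] dp_scale(1)[OF C] f)
    finally show ?thesis .
  qed
  have "A' (E u) = 0" if "dp E E'" for E E'
    using nz z[OF _ that] by (elim exE) (rule separating[of f "(*)"], auto simp: f)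
  moreover obtain E E' where "dp E E'" "E u = v" using dp_transitive[OF T(2)] by blast
  ultimately show ?thesis by blast
qed

theorem dim_invariants:
  assumes conj: "\<forall>g\<in>carrier G. \<exists>x\<in>carrier G. x \<otimes> g \<otimes> inv x = inv g"
    and H: "subgroup H G"
    and double_coset: "\<And>g. g \<in> carrier G \<Longrightarrow> \<exists>h1\<in>H. \<exists>h2\<in>H. inv g = h1 \<otimes> g \<otimes> h2"
  shows "dim_at_most scale (invariants H \<pi>) 1"
proof -
  have HG: "H \<subseteq> carrier G" and H_inv: "\<And>h. h \<in> H \<Longrightarrow> inv h \<in> H"
    using H by (auto simp: subgroup.subset subgroup.m_inv_closed)
  obtain T T' u f where T: "dp T T'" "u \<noteq> 0" "\<And>v. T v = scale (f v) u" and nz: "\<exists>v. f v \<noteq> 0"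
    and f: "\<And>v w. f (v + w) = f v + f w" "\<And>c v. f (scale c v) = c * f v"
    using ex_rank_one by blast
  have line: "\<exists>c. v2 = scale c v1"
    if v1: "v1 \<in> invariants H \<pi>" "v1 \<noteq> 0" and v2: "v2 \<in> invariants H \<pi>" for v1 v2
  proof -
    have inv: "\<pi> h v1 = v1" "\<pi> h v2 = v2" if "h \<in> H" for h using v1(1) v2 that by (auto simp: invariants_def)
    obtain A0 A0' where A0: "dp A0 A0'" "A0 u = v1" using dp_transitive[OF T(2)] by blast
    \<comment> \<open>\<open>?R\<close> has the line of \<open>v1\<close> as its image. Its dual
      \<open>?\<Lambda>\<close> plays the part of the invariant functional, with vectors as
      values.\<close>
    let ?R = "\<lambda>v. A0 (T v)" and ?\<Lambda> = "\<lambda>v. T' (A0' v)"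
    have R: "dp ?R ?\<Lambda>" by (rule dp_comp[OF A0(1) T(1)])
    have R_eq: "?R v = scale (f v) v1" for v by (simp add: T(3) dp_scale(1)[OF A0(1)] A0(2))
    \<comment> \<open>The image of \<open>?R\<close> consists of invariant vectors, so \<pi>(h^-1) R
      = R; passing to duals gives the claim.\<close>
    have \<Lambda>_H: "?\<Lambda> (\<pi> h v) = ?\<Lambda> v" if h: "h \<in> H" for h v
    proof -
      have h': "inv h \<in> carrier G" "h \<in> carrier G" using h HG by auto
      have dpd: "dp (\<lambda>v. \<pi> (inv h) (?R v) - ?R v) (\<lambda>v. ?\<Lambda> (\<pi> h v) - ?\<Lambda> v)"
        using dp_diff[OF dp_comp[OF dual_pair.base[OF h'(1)] R] R] h' by simp
      have zero: "\<pi> (inv h) (?R v) - ?R v = 0" for v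
        using vector_endomorphism.f_scale[OF \<pi>_linear[OF h'(1)]] inv[OF H_inv[OF h]] by (simp add: R_eq)
      show ?thesis using dp_zero_left[OF conj dpd zero, of v] by simp
    qed
    have \<Lambda>_nz: "\<exists>v. ?\<Lambda> v \<noteq> 0"
    proof (rule ccontr)
      assume "\<nexists>v. ?\<Lambda> v \<noteq> 0"
      then have "?\<Lambda> v = 0" for v by blast
      then have "?R v = 0" for v by (rule dp_zero_left[OF conj dp_sym[OF R]])
      then show False using nz v1(2) by (auto simp: R_eq)
    qed
    \<comment> \<open>On group elements the inverse is h1 g h2; here h2 fixes \<open>v\<close>, and
      \<open>?\<Lambda>\<close> absorbs h1.\<close>
    have \<Lambda>_sym: "?\<Lambda> (A v) = ?\<Lambda> (A' v)" if "dp A A'" "\<And>h. h \<in> H \<Longrightarrow> \<pi> h v = v" for A A' v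
      using that(1)
    proof (induction rule: dual_pair.induct)
      case (base g)
      obtain h1 h2 where h: "h1 \<in> H" "h2 \<in> H" "inv g = h1 \<otimes> g \<otimes> h2" using double_coset[OF base] by blast
      then have "\<pi> (inv g) v = \<pi> h1 (\<pi> g v)"
        using HG base that(2)[OF h(2)] by (simp add: \<pi>_mult subset_iff)
      then show ?case using \<Lambda>_H[OF h(1)] by simp
    qed (simp_all add: dp_add(2)[OF R] dp_scale(2)[OF R])
    have sep: "x = 0" if "\<And>C C'. dp C C' \<Longrightarrow> ?\<Lambda> (C x) = 0" for x
      using \<Lambda>_nz that by (elim exE) (rule separating[of ?\<Lambda> scale], auto simp: dp_add(2)[OF R] dp_scale(2)[OF R])
    \<comment> \<open>Since \<Lambda>(C A v) = \<Lambda>(A' C' v) for invariant \<open>v\<close>,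
      the assumption on \<open>v1\<close> makes \<Lambda> A' vanish on all C' v1, that is,
      everywhere. The same identity for \<open>v2\<close> then gives \<Lambda>(C A v2) = 0.\<close>
    have ann: "A v2 = 0" if A: "dp A A'" and "A v1 = 0" for A A'
    proof (rule sep)
      have C_eq: "?\<Lambda> (C (A v)) = ?\<Lambda> (A' (C' v))" if "dp C C'" "\<And>h. h \<in> H \<Longrightarrow> \<pi> h v = v" for C C' v
        using \<Lambda>_sym[OF dp_comp[OF that(1) A] that(2)] .
      have 0: "?\<Lambda> (A' (C' v1)) = 0" if "dp C C'" for C C'
        using C_eq[OF that inv(1)] \<open>A v1 = 0\<close> vector_endomorphism.f_zero[OF dp_linear(1)[OF that]]
          vector_endomorphism.f_zero[OF dp_linear(2)[OF R]] by simp
      have "?\<Lambda> (A' w) = 0" for w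
      proof -
        obtain C' C where "dp C' C" "C' v1 = w" using dp_transitive[OF v1(2)] by blast
        then show ?thesis using 0 dp_sym by blast
      qed
      then show "?\<Lambda> (C (A v2)) = 0" if "dp C C'" for C C' using C_eq[OF that inv(2)] by simp
    qed
    \<comment> \<open>\<open>B0\<close> serves as normalization: \<open>T C\<close> and a suitable
      multiple of \<open>T B0\<close> agree at \<open>v1\<close>, hence at \<open>v2\<close> by
      \<open>ann\<close>. Comparing the coefficients of \<open>u\<close> gives f(C v2) = m f(C v1),
      where m stands for \<open>?m\<close>.\<close>
    obtain y0 where y0: "f y0 \<noteq> 0" using nz by blast
    obtain B0 B0' where B0: "dp B0 B0'" "B0 v1 = y0" using dp_transitive[OF v1(2)] by blast
    let ?m = "f (B0 v2) / f y0"
    have "v2 - scale ?m v1 = 0"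
    proof (rule separating[of f "(*)"])
      fix C C' assume C: "dp C C'"
      have dpd: "dp (\<lambda>v. T (C v) - scale (f (C v1) / f y0) (T (B0 v))) (\<lambda>v. C' (T' v) - scale (f (C v1) / f y0) (B0' (T' v)))"
        by (rule dp_diff[OF dp_comp[OF T(1) C] dual_pair.scale[OF dp_comp[OF T(1) B0(1)]]])
      have "T (C v1) - scale (f (C v1) / f y0) (T (B0 v1)) = 0"
        using y0 by (simp add: T(3) B0(2))
      then have "T (C v2) - scale (f (C v1) / f y0) (T (B0 v2)) = 0" by (rule ann[OF dpd])
      then have "scale (f (C v2) - f (C v1) / f y0 * f (B0 v2)) u = 0"
        by (simp add: T(3) scale_left_diff_distrib)
      then have "f (C v2) = f (C v1) / f y0 * f (B0 v2)" using T(2) by (simp add: scale_eq_0_iff)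
      moreover have "f (C v2) = f (C (v2 - scale ?m v1)) + ?m * f (C v1)"
        using dp_add(1)[OF C, of "v2 - scale ?m v1" "scale ?m v1"] by (simp add: dp_scale(1)[OF C] f)
      ultimately show "f (C (v2 - scale ?m v1)) = 0" by (simp add: mult.commute)
    qed (use f y0 in auto)
    then show ?thesis by auto
  qed
  show ?thesis
  proof (cases "invariants H \<pi> = {0}")
    case True
    have "dim {0} \<le> card ({} :: 'v set)" by (rule dim_le_card) auto
    then show ?thesis unfolding dim_at_most_def True by (intro conjI exI[of _ "{}"]) auto
  next
    case False
    have zero: "0 \<in> invariants H \<pi>"
      using HG vector_endomorphism.f_zero[OF \<pi>_linear] by (auto simp: invariants_def)
    then obtain v1 where v1: "v1 \<in> invariants H \<pi>" "v1 \<noteq> 0" using False by blast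
    have "scale c v1 \<in> invariants H \<pi>" for c
      using v1(1) HG vector_endomorphism.f_scale[OF \<pi>_linear] by (auto simp: invariants_def subset_iff)
    then have "span {v1} = invariants H \<pi>"
      using line[OF v1] by (fastforce simp: span_singleton)
    moreover have "dim (invariants H \<pi>) \<le> card {v1}"
      using calculation by (intro dim_le_card) auto
    ultimately show ?thesis unfolding dim_at_most_def by (intro conjI exI[of _ "{v1}"]) auto
  qed
qed

end

section \<open>Moving vectors by reflections\<close>

context bilinear_space
begin

lemma isometry_on_reflection:
  assumes "subspace U" "u \<in> U" "B u u \<noteq> 0"
  shows "isometry_on U (\<lambda>v. v - scale (2 * B v u / B u u) u)"
  unfolding isometry_on_def
proof (intro conjI ballI allI)
  show "v - scale (2 * B v u / B u u) u \<in> U" if "v \<in> U" for v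
    using that assms by (simp add: subspace_diff subspace_scale)
  show "v + w - scale (2 * B (v + w) u / B u u) u
      = v - scale (2 * B v u / B u u) u + (w - scale (2 * B w u / B u u) u)" for v w
    by (simp add: B_add distrib_left add_divide_distrib scale_left_distrib)
  show "scale a v - scale (2 * B (scale a v) u / B u u) u = scale a (v - scale (2 * B v u / B u u) u)" for a v
    by (simp add: B_scale scale_right_diff_distrib mult.left_commute)
  show "B (v - scale (2 * B v u / B u u) u) (w - scale (2 * B w u / B u u) u) = B v w" for v w
    using assms(3) by (simp add: B_simps B_sym[of u w] field_simps)
qed

text \<open>Fixing \<open>x\<close> keeps the isometry in the stabilizer of \<open>x\<close>, which
  becomes the subgroup once \<open>x\<close> is the last basis vector.\<close>

definition moves :: "'v set \<Rightarrow> 'v \<Rightarrow> 'v \<Rightarrow> 'v \<Rightarrow> bool" where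
  "moves U x a b \<longleftrightarrow> (\<exists>h. isometry_on U h \<and> h x = x \<and> h a = b)"

lemma moves_trans: "moves U x a b \<Longrightarrow> moves U x b c \<Longrightarrow> moves U x a c"
  unfolding moves_def
proof (elim exE conjE)
  fix h k assume h: "isometry_on U h" "h x = x" "h a = b" and k: "isometry_on U k" "k x = x" "k b = c"
  have "isometry_on U (k \<circ> h)" using h(1) k(1) by (simp add: isometry_on_def)
  then show "\<exists>h. isometry_on U h \<and> h x = x \<and> h a = c" using h k by (intro exI[of _ "k \<circ> h"]) simp
qed

lemma moves_refl: "moves U x a a"
  unfolding moves_def by (intro exI[of _ id]) (simp add: isometry_on_def)

text \<open>The reflection in \<open>a - b\<close> exchanges vectors of equal norm, and it fixes
  \<open>x\<close> because \<open>a - b\<close> is orthogonal to \<open>x\<close>.\<close>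

lemma moves_reflection:
  assumes U: "subspace U" "a \<in> U" "b \<in> U" and x: "B a x = 0" "B b x = 0"
    and eq: "B a a = B b b" and nz: "B (a - b) (a - b) \<noteq> 0"
  shows "moves U x a b"
  unfolding moves_def
proof (intro exI conjI)
  show "isometry_on U (\<lambda>v. v - scale (2 * B v (a - b) / B (a - b) (a - b)) (a - b))"
    using U nz by (intro isometry_on_reflection) (auto simp: subspace_diff)
  show "x - scale (2 * B x (a - b) / B (a - b) (a - b)) (a - b) = x"
    using x by (simp add: B_simps B_sym[of x])
  have "2 * B a (a - b) = B (a - b) (a - b)" using eq by (simp add: B_simps B_sym[of b a])
  then show "a - scale (2 * B a (a - b) / B (a - b) (a - b)) (a - b) = b" using nz by simp
qed

lemma four_neq_zero: "(4::'a) \<noteq> 0"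
proof -
  have "(4::'a) = 2 * 2" by simp
  then show ?thesis using two by (metis mult_eq_0_iff)
qed

text \<open>Witt's theorem for single vectors in the complement of \<open>x\<close>, using at most
  two reflections.\<close>

lemma moves_orthogonal:
  assumes U: "subspace U" "nondegenerate_on U" "x \<in> U" "B x x = 1"
    and a: "a \<in> U" "B a x = 0" and b: "b \<in> U" "B b x = 0"
    and eq: "B a a = B b b" and zero: "a = 0 \<longleftrightarrow> b = 0"
  shows "moves U x a b"
proof (cases "B (a - b) (a - b) = 0")
  case False
  then show ?thesis using moves_reflection U(1) a b eq by blast
next
  case True
  then have ab: "2 * B a b = 2 * B a a" using eq by (auto simp: B_simps B_sym[of b a])
  show ?thesis
  proof (cases "B a a = 0")
    \<comment> \<open>Since \<open>a - b\<close> is isotropic, \<open>a + b\<close> has norm 4 B(a,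
      a), which is nonzero. Go from \<open>a\<close> to \<open>- b\<close>, then to
      \<open>b\<close>.\<close>
    case False
    have nb: "- b \<in> U" "B (- b) x = 0" "B (- b) (- b) = B b b"
      using b U(1) by (simp_all add: subspace_neg B_simps)
    have "B (a - - b) (a - - b) = 4 * B a a" using ab eq by (simp add: B_simps B_sym[of b a])
    then have "moves U x a (- b)" using False four_neq_zero eq nb U(1) a by (intro moves_reflection) auto
    moreover have "B (- b - b) (- b - b) = 4 * B b b" by (simp add: B_simps)
    then have "moves U x (- b) b" using False four_neq_zero eq nb U(1) b by (intro moves_reflection) auto
    ultimately show ?thesis by (rule moves_trans)
  next
    case Na: True
    then have Nb: "B b b = 0" and Nab: "B a b = 0" using eq ab two by auto
    show ?thesis
    proof (cases "a = 0")
      case True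
      then show ?thesis using zero moves_refl by simp
    next
      case False
      obtain p where p: "p \<in> U" "B a p \<noteq> 0" using False U(2) a(1) unfolding nondegenerate_on_def by blast
      obtain q where q: "q \<in> U" "B b q \<noteq> 0" using False zero U(2) b(1) unfolding nondegenerate_on_def by blast
      \<comment> \<open>If neither \<open>p\<close> nor \<open>q\<close> pairs nontrivially with
        both \<open>a\<close> and \<open>b\<close>, then \<open>p + q\<close> does.\<close>
      obtain r where r: "r \<in> U" "B a r \<noteq> 0" "B b r \<noteq> 0"
      proof (cases "B b p = 0 \<and> B a q = 0")
        case True
        then have "B a (p + q) \<noteq> 0" "B b (p + q) \<noteq> 0" using p q by (simp_all add: B_simps)
        then show thesis using that p q U(1) subspace_add by blast
      next
        case False
        then show thesis using that p q by blast
      qed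
      define s where "s = r - scale (B r x) x"
      have s: "s \<in> U" "B s x = 0" "B a s \<noteq> 0" "B b s \<noteq> 0"
        using r a b U by (simp_all add: s_def B_simps subspace_diff subspace_scale)
      \<comment> \<open>Subtracting this multiple of the isotropic \<open>a\<close> makes
        \<open>w\<close> isotropic and leaves its pairings with \<open>a\<close> and
        \<open>b\<close> unchanged; \<open>w\<close> serves as the intermediate stop between
        them.\<close>
      define w where "w = s - scale (B s s / (2 * B a s)) a"
      have w: "w \<in> U" "B w x = 0" "B a w \<noteq> 0" "B w b \<noteq> 0"
        using s a b U(1) Na Nab by (simp_all add: w_def B_simps subspace_diff subspace_scale B_sym[of s b])
      have "B w w = 0" using s(3) Na two by (simp add: w_def B_simps B_sym[of s a] field_simps)
      then have "B (a - w) (a - w) = - (2 * B a w)" "B (w - b) (w - b) = - (2 * B w b)"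
        using Na Nb by (simp_all add: B_simps B_sym[of w a] B_sym[of b w])
      then have "moves U x a w" "moves U x w b"
        using U(1) a b w \<open>B w w = 0\<close> Na Nb two by (intro moves_reflection; simp)+
      then show ?thesis by (rule moves_trans)
    qed
  qed
qed

text \<open>\<open>y\<close> and \<open>z\<close> have the same component along \<open>x\<close>,
  and \<open>line\<close> says that their remainders vanish simultaneously.\<close>

lemma moves_vector:
  assumes U: "subspace U" "nondegenerate_on U" "x \<in> U" "B x x = 1"
    and y: "y \<in> U" and z: "z \<in> U" and eq: "B y y = B z z" "B y x = B z x"
    and line: "y = scale (B y x) x \<longleftrightarrow> z = scale (B y x) x"
  shows "moves U x y z"
proof -
  let ?c = "scale (B y x) x"
  have c: "?c \<in> U" using U by (simp add: subspace_scale)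
  have "moves U x (y - ?c) (z - ?c)"
  proof (rule moves_orthogonal[OF U])
    show "B (y - ?c) (y - ?c) = B (z - ?c) (z - ?c)"
      using eq U(4) by (simp add: B_simps B_sym[of x y] B_sym[of x z])
  qed (use y z c U(1,4) eq line in \<open>auto simp: subspace_diff B_simps\<close>)
  then obtain h where h: "isometry_on U h" "h x = x" "h (y - ?c) = z - ?c" unfolding moves_def by blast
  have "h y = h ((y - ?c) + ?c)" by simp
  also have "\<dots> = h (y - ?c) + h ?c"
    using h(1) c y U(1) subspace_diff unfolding isometry_on_def by blast
  also have "h ?c = ?c" using h(1,2) U(3) unfolding isometry_on_def by metis
  finally have "h y = z" using h(3) by simp
  then show ?thesis using h unfolding moves_def by blast
qed

end

text \<open>A largest additive subgroup of 2-power order is the whole field, since adjoining another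
  coset would double it.\<close>

lemma char_2_card_power:
  assumes "(2::'q::{field,finite}) = 0"
  shows "\<exists>k. card (UNIV :: 'q set) = 2 ^ k"
proof -
  define P where "P S \<longleftrightarrow> 0 \<in> S \<and> (\<forall>x\<in>S. \<forall>y\<in>S. x + y \<in> S) \<and> (\<exists>k. card S = 2 ^ k)" for S :: "'q set"
  have dbl: "x + x = 0" for x :: 'q using assms by (metis mult_2 mult_zero_left)
  have "P {0}" by (auto simp: P_def intro: exI[of _ 0])
  moreover have "\<forall>S. P S \<longrightarrow> card S < Suc (card (UNIV :: 'q set))"
    by (simp add: card_mono less_Suc_eq_le)
  ultimately have "\<exists>S. P S \<and> (\<forall>T. P T \<longrightarrow> card T \<le> card S)" by (rule ex_has_greatest_nat)
  then obtain S where P: "P S" and max: "\<And>T. P T \<Longrightarrow> card T \<le> card S" by blast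
  from P obtain k where "card S = 2 ^ k" unfolding P_def by blast
  with P have S: "0 \<in> S" "\<And>x y. x \<in> S \<Longrightarrow> y \<in> S \<Longrightarrow> x + y \<in> S" "card S = 2 ^ k"
    by (simp_all add: P_def)
  have "S = UNIV"
  proof (rule ccontr)
    assume "S \<noteq> UNIV"
    then obtain a where a: "a \<notin> S" by blast
    let ?T = "S \<union> (+) a ` S"
    have disj: "S \<inter> (+) a ` S = {}"
    proof (rule ccontr)
      assume "S \<inter> (+) a ` S \<noteq> {}"
      then obtain s where s: "s \<in> S" "a + s \<in> S" by auto
      then have "a + s + s \<in> S" using S(2) by blast
      then show False using a dbl[of s] by (simp add: add.assoc)
    qed
    have "card ?T = card S + card ((+) a ` S)" using disj by (intro card_Un_disjoint) auto
    also have "card ((+) a ` S) = card S" by (intro card_image) auto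
    finally have card: "card ?T = 2 ^ Suc k" using S(3) by simp
    have "x + y \<in> ?T" if x: "x \<in> ?T" and y: "y \<in> ?T" for x y
    proof -
      obtain s i where s: "s \<in> S" "x = i + s" "i = 0 \<or> i = a" using x by force
      obtain t j where t: "t \<in> S" "y = j + t" "j = 0 \<or> j = a" using y by force
      have "x + y = (i + j) + (s + t)" using s t by simp
      moreover have "i + j = 0 \<or> i + j = a" using s(3) t(3) assms by auto
      ultimately show ?thesis using S(2)[OF s(1) t(1)] by auto
    qed
    moreover have "0 \<in> ?T" using S(1) by simp
    ultimately have "P ?T" unfolding P_def using card by (intro conjI ballI exI[of _ "Suc k"])
    then have "card ?T \<le> card S" by (rule max)
    then show False using card S(3) by simp
  qed
  then show ?thesis using S(3) by blast
qed

section \<open>Orthogonal matrices\<close>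

text \<open>Vectors are sequences because the locales need a whole type of vectors; F^m is the
  subspace \<open>coord_space m\<close>.\<close>

definition fscale :: "'a::times \<Rightarrow> (nat \<Rightarrow> 'a) \<Rightarrow> nat \<Rightarrow> 'a" where
  "fscale a f = (\<lambda>i. a * f i)"

definition dot :: "nat \<Rightarrow> (nat \<Rightarrow> 'a::comm_semiring_0) \<Rightarrow> (nat \<Rightarrow> 'a) \<Rightarrow> 'a" where
  "dot m f h = (\<Sum>i<m. f i * h i)"

definition coord_space :: "nat \<Rightarrow> (nat \<Rightarrow> 'a::zero) set" where
  "coord_space m = {f. \<forall>i\<ge>m. f i = 0}"

definition unit_fun :: "nat \<Rightarrow> nat \<Rightarrow> 'a::{zero,one}" where
  "unit_fun j = (\<lambda>i. if i = j then 1 else 0)"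

text \<open>Acting as the identity on the coordinates beyond the matrix size makes the action of an
  invertible matrix bijective on all sequences.\<close>

definition mat_act :: "nat \<Rightarrow> 'a::comm_semiring_0 mat \<Rightarrow> (nat \<Rightarrow> 'a) \<Rightarrow> nat \<Rightarrow> 'a" where
  "mat_act m A f = (\<lambda>i. if i < m then \<Sum>j<m. A $$ (i, j) * f j else f i)"

definition mat_of_fun :: "nat \<Rightarrow> ((nat \<Rightarrow> 'a::{zero,one}) \<Rightarrow> nat \<Rightarrow> 'a) \<Rightarrow> 'a mat" where
  "mat_of_fun m h = mat m m (\<lambda>(i, j). h (unit_fun j) i)"

lemma vector_space_fscale: "vector_space (fscale :: 'a::field \<Rightarrow> _)"
  by unfold_locales (auto simp: fscale_def algebra_simps)

lemma bilinear_space_dot: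
  assumes "(2::'a::field) \<noteq> 0"
  shows "bilinear_space (fscale :: 'a \<Rightarrow> _) (dot m)"
proof -
  interpret vector_space "fscale :: 'a \<Rightarrow> _" by (rule vector_space_fscale)
  show ?thesis
    using assms by unfold_locales
      (auto simp: dot_def fscale_def sum.distrib sum_distrib_left algebra_simps)
qed

lemma dot_unit_fun: "i < m \<Longrightarrow> dot m f (unit_fun i) = (f i :: 'a::comm_semiring_1)"
  by (simp add: dot_def unit_fun_def if_distrib[of "\<lambda>x. _ * x"] cong: if_cong)

lemma unit_fun_in_coord_space: "j < m \<Longrightarrow> unit_fun j \<in> coord_space m"
  by (auto simp: unit_fun_def coord_space_def)

lemma subspace_coord_space: "module.subspace (fscale :: 'a::field \<Rightarrow> _) (coord_space m)"
proof -
  interpret vector_space "fscale :: 'a \<Rightarrow> _" by (rule vector_space_fscale)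
  show ?thesis by (auto simp: subspace_def coord_space_def fscale_def)
qed

lemma finite_coord_space: "finite (coord_space m :: (nat \<Rightarrow> 'a::{finite,zero}) set)"
proof -
  have "coord_space m \<subseteq> (\<lambda>f i. if i < m then f i else (0::'a)) ` (PiE {..<m} (\<lambda>_. UNIV))"
  proof
    fix f :: "nat \<Rightarrow> 'a" assume "f \<in> coord_space m"
    then have "f = (\<lambda>i. if i < m then restrict f {..<m} i else 0)"
      by (auto simp: coord_space_def fun_eq_iff)
    then show "f \<in> (\<lambda>f i. if i < m then f i else (0::'a)) ` (PiE {..<m} (\<lambda>_. UNIV))"
      by (intro image_eqI[where x = "restrict f {..<m}"]) auto
  qed
  then show ?thesis by (rule finite_subset) (intro finite_imageI finite_PiE; simp)
qed

lemma (in bilinear_space) nondegenerate_onI: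
  "(\<And>u. u \<in> U \<Longrightarrow> (\<And>v. v \<in> U \<Longrightarrow> B u v = 0) \<Longrightarrow> u = 0) \<Longrightarrow> nondegenerate_on U"
  by (auto simp: nondegenerate_on_def)

lemma nondegenerate_coord_space:
  assumes "(2::'a::field) \<noteq> 0"
  shows "bilinear_space.nondegenerate_on (dot m) (coord_space m :: (nat \<Rightarrow> 'a) set)"
proof -
  interpret bilinear_space "fscale :: 'a \<Rightarrow> _" "dot m" using assms by (rule bilinear_space_dot)
  show ?thesis
  proof (rule nondegenerate_onI)
    fix u :: "nat \<Rightarrow> 'a" assume u: "u \<in> coord_space m" "\<And>v. v \<in> coord_space m \<Longrightarrow> dot m u v = 0"
    have "u i = 0" for i
      using u(2)[OF unit_fun_in_coord_space[of i m]] u(1) dot_unit_fun[of i m u]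
      by (cases "i < m") (auto simp: coord_space_def)
    then show "u = 0" by auto
  qed
qed

lemma mat_act_mult:
  fixes A :: "'a::comm_semiring_1 mat"
  assumes "A \<in> carrier_mat m m" "C \<in> carrier_mat m m"
  shows "mat_act m (A * C) f = mat_act m A (mat_act m C f)"
proof
  fix i
  show "mat_act m (A * C) f i = mat_act m A (mat_act m C f) i"
  proof (cases "i < m")
    case True
    have "mat_act m (A * C) f i = (\<Sum>j<m. \<Sum>k<m. A $$ (i, k) * C $$ (k, j) * f j)"
      using True assms by (simp add: mat_act_def scalar_prod_def sum_distrib_right atLeast0LessThan)
    also have "\<dots> = (\<Sum>k<m. \<Sum>j<m. A $$ (i, k) * C $$ (k, j) * f j)" by (rule sum.swap)
    also have "\<dots> = mat_act m A (mat_act m C f) i"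
      using True by (simp add: mat_act_def sum_distrib_left mult.assoc)
    finally show ?thesis .
  qed (simp add: mat_act_def)
qed

lemma mat_act_one: "mat_act m (1\<^sub>m m) f = (f :: nat \<Rightarrow> 'a::comm_semiring_1)"
  by (auto simp: mat_act_def fun_eq_iff if_distrib[of "\<lambda>x. x * _"] cong: if_cong)

lemma mat_act_unit_fun: "i < m \<Longrightarrow> j < m \<Longrightarrow> mat_act m A (unit_fun j) i = (A $$ (i, j) :: 'a::comm_semiring_1)"
  by (simp add: mat_act_def unit_fun_def if_distrib[of "\<lambda>x. _ * x"] cong: if_cong)

lemma mat_act_in_coord_space: "f \<in> coord_space m \<Longrightarrow> mat_act m A f \<in> coord_space m"
  by (simp add: mat_act_def coord_space_def)

lemma mat_eq_if_act_eq:
  fixes A :: "'a::comm_semiring_1 mat"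
  assumes "A \<in> carrier_mat m m" "C \<in> carrier_mat m m"
    and "\<And>f. f \<in> coord_space m \<Longrightarrow> mat_act m A f = mat_act m C f"
  shows "A = C"
proof (rule eq_matI)
  fix i j assume "i < dim_row C" "j < dim_col C"
  then have "i < m" "j < m" using assms(2) by auto
  then show "A $$ (i, j) = C $$ (i, j)"
    using assms(3)[OF unit_fun_in_coord_space[of j m]] mat_act_unit_fun by metis
qed (use assms in auto)

lemma dot_mat_act:
  fixes A :: "'a::comm_semiring_1 mat"
  assumes "A \<in> carrier_mat m m"
  shows "dot m (mat_act m A f) h = dot m f (mat_act m (transpose_mat A) h)"
proof -
  have "dot m (mat_act m A f) h = (\<Sum>i<m. \<Sum>j<m. A $$ (i, j) * f j * h i)"
    by (simp add: dot_def mat_act_def sum_distrib_right)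
  also have "\<dots> = (\<Sum>j<m. \<Sum>i<m. A $$ (i, j) * f j * h i)" by (rule sum.swap)
  also have "\<dots> = dot m f (mat_act m (transpose_mat A) h)"
    using assms by (simp add: dot_def mat_act_def sum_distrib_left mult_ac)
  finally show ?thesis .
qed

section \<open>The orthogonal group as a finite group of matrices\<close>

lemma orthogonal_group_sel [simp]:
  "mult (orthogonal_group TYPE('a::field) m) = (*)" "one (orthogonal_group TYPE('a) m) = 1\<^sub>m m"
  by (simp_all add: orthogonal_group_def GL_group_def units_of_def ring_mat_def)

text \<open>A left inverse of a square matrix over a field is two-sided, so the orthogonality
  equation already gives a unit.\<close>

lemma carrier_orthogonal_group:
  "carrier (orthogonal_group TYPE('a::field) m) = {A \<in> carrier_mat m m. transpose_mat A * A = 1\<^sub>m m}"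
proof -
  have "A \<in> Units (ring_mat TYPE('a) m ())" if "A \<in> carrier_mat m m" "transpose_mat A * A = 1\<^sub>m m" for A
    using that mat_mult_left_right_inverse[OF _ _ that(2)]
    by (auto simp: Units_def ring_mat_def intro!: bexI[of _ "transpose_mat A"])
  then show ?thesis
    by (auto simp: orthogonal_group_def GL_group_def units_of_def) (auto simp: Units_def ring_mat_def)
qed

lemma orthogonal_groupD:
  assumes "A \<in> carrier (orthogonal_group TYPE('a::field) m)"
  shows "A \<in> carrier_mat m m" "transpose_mat A \<in> carrier_mat m m"
    "transpose_mat A * A = 1\<^sub>m m" "A * transpose_mat A = 1\<^sub>m m"
  using assms mat_mult_left_right_inverse[of "transpose_mat A" m A]
  by (auto simp: carrier_orthogonal_group)

lemma transpose_orthogonal: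
  assumes "A \<in> carrier (orthogonal_group TYPE('a::field) m)"
  shows "transpose_mat A \<in> carrier (orthogonal_group TYPE('a) m)"
  using orthogonal_groupD[OF assms] by (simp add: carrier_orthogonal_group)

lemma group_orthogonal_group: "group (orthogonal_group TYPE('a::field) m)"
proof (rule groupI)
  fix A C assume A: "A \<in> carrier (orthogonal_group TYPE('a) m)" and C: "C \<in> carrier (orthogonal_group TYPE('a) m)"
  note A' = orthogonal_groupD[OF A] and C' = orthogonal_groupD[OF C]
  have "transpose_mat A * (A * C) = C"
    using A' C' by (simp flip: assoc_mult_mat[of _ m m _ m _ m])
  then have "transpose_mat (A * C) * (A * C) = 1\<^sub>m m"
    using A' C' by (simp add: transpose_mult[of _ m m] assoc_mult_mat[of _ m m _ m _ m])
  then show "A \<otimes>\<^bsub>orthogonal_group TYPE('a) m\<^esub> C \<in> carrier (orthogonal_group TYPE('a) m)"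
    using A' C' by (simp add: carrier_orthogonal_group)
next
  fix A assume A: "A \<in> carrier (orthogonal_group TYPE('a) m)"
  show "\<exists>C\<in>carrier (orthogonal_group TYPE('a) m).
      C \<otimes>\<^bsub>orthogonal_group TYPE('a) m\<^esub> A = \<one>\<^bsub>orthogonal_group TYPE('a) m\<^esub>"
    using transpose_orthogonal[OF A] orthogonal_groupD[OF A] by auto
qed (auto simp: carrier_orthogonal_group)

lemma inv_orthogonal_group:
  assumes "A \<in> carrier (orthogonal_group TYPE('a::field) m)"
  shows "inv\<^bsub>orthogonal_group TYPE('a) m\<^esub> A = transpose_mat A"
  using group.inv_equality[OF group_orthogonal_group _ assms transpose_orthogonal[OF assms]]
    orthogonal_groupD[OF assms] by simp

lemma finite_orthogonal_group: "finite (carrier (orthogonal_group TYPE('a::{field,finite}) m))"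
proof -
  have "carrier_mat m m \<subseteq> (\<lambda>f. mat m m f) ` (PiE ({..<m} \<times> {..<m}) (\<lambda>_. UNIV :: 'a set))"
  proof
    fix A :: "'a mat" assume "A \<in> carrier_mat m m"
    then have "A = mat m m (restrict (\<lambda>ij. A $$ ij) ({..<m} \<times> {..<m}))" by (intro eq_matI) auto
    then show "A \<in> (\<lambda>f. mat m m f) ` (PiE ({..<m} \<times> {..<m}) (\<lambda>_. UNIV))"
      by (intro image_eqI[where x = "restrict (\<lambda>ij. A $$ ij) ({..<m} \<times> {..<m})"]) auto
  qed
  then have "finite (carrier_mat m m :: 'a mat set)"
    by (rule finite_subset) (intro finite_imageI finite_PiE; simp)
  then show ?thesis by (rule finite_subset[rotated]) (auto simp: carrier_orthogonal_group)
qed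

section \<open>Orthogonal matrices and isometries of the coordinate space\<close>

context
  fixes m :: nat
  assumes two_nz: "(2::'a::field) \<noteq> 0"
begin

interpretation bilinear_space "fscale :: 'a \<Rightarrow> _" "dot m" using two_nz by (rule bilinear_space_dot)

lemma mat_act_isometry:
  assumes "A \<in> carrier (orthogonal_group TYPE('a) m)"
  shows "isometry fscale (dot m) (mat_act m A) (mat_act m (transpose_mat A))"
proof -
  note A = orthogonal_groupD[OF assms]
  have inv: "mat_act m (transpose_mat A) (mat_act m A f) = f" "mat_act m A (mat_act m (transpose_mat A) f) = f" for f
    using A by (simp_all add: mat_act_mult[symmetric] mat_act_one)
  show ?thesis
  proof unfold_locales
    show "mat_act m A (u + v) = mat_act m A u + mat_act m A v" for u v
      by (auto simp: mat_act_def fun_eq_iff sum.distrib algebra_simps)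
    show "mat_act m A (fscale a u) = fscale a (mat_act m A u)" for a u
      by (auto simp: mat_act_def fun_eq_iff fscale_def sum_distrib_left algebra_simps)
    show "dot m (mat_act m A u) (mat_act m A v) = dot m u v" for u v
      using A(1) by (simp add: dot_mat_act inv)
  qed (rule inv)+
qed

text \<open>Additivity is available only on \<open>coord_space m\<close>, so the induction also
  carries membership of the partial sums.\<close>

lemma isometry_on_sum_unit_fun:
  assumes h: "isometry_on (coord_space m) h" and "finite J" "J \<subseteq> {..<m}"
  shows "h (\<Sum>j\<in>J. fscale (c j) (unit_fun j)) = (\<Sum>j\<in>J. fscale (c j) (h (unit_fun j)))
    \<and> (\<Sum>j\<in>J. fscale (c j) (unit_fun j)) \<in> coord_space m"
  using assms(2,3)
proof (induction J)
  case empty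
  have 0: "0 \<in> (coord_space m :: (nat \<Rightarrow> 'a) set)" by (rule subspace_0[OF subspace_coord_space])
  then have "h (fscale 0 0) = fscale 0 (h 0)" using h unfolding isometry_on_def by blast
  then have "h 0 = 0" by simp
  then show ?case using 0 by (simp only: sum.empty simp_thms)
next
  case (insert j J)
  let ?e = "unit_fun j :: nat \<Rightarrow> 'a"
  have e: "?e \<in> coord_space m" using insert.prems by (simp add: unit_fun_in_coord_space)
  then have ce: "fscale (c j) ?e \<in> coord_space m" using subspace_scale[OF subspace_coord_space] by blast
  let ?f = "\<Sum>j\<in>J. fscale (c j) (unit_fun j)"
  have IH: "h ?f = (\<Sum>j\<in>J. fscale (c j) (h (unit_fun j)))" "?f \<in> coord_space m"
    using insert.IH insert.prems by blast+
  have "h (fscale (c j) ?e + ?f) = h (fscale (c j) ?e) + h ?f"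
    using h ce IH(2) unfolding isometry_on_def by blast
  moreover have "h (fscale (c j) ?e) = fscale (c j) (h ?e)"
    using h e unfolding isometry_on_def by blast
  moreover have "fscale (c j) ?e + ?f \<in> coord_space m"
    using ce IH(2) by (rule subspace_add[OF subspace_coord_space])
  ultimately show ?case
    by (simp only: sum.insert[OF insert.hyps] IH(1) simp_thms)
qed

text \<open>The columns are the images of the standard basis, which stay orthonormal under
  \<open>h\<close>.\<close>

lemma mat_of_isometry:
  assumes h: "isometry_on (coord_space m) h"
  shows "mat_of_fun m h \<in> carrier (orthogonal_group TYPE('a) m)"
    and "f \<in> coord_space m \<Longrightarrow> mat_act m (mat_of_fun m h) f = h f"
proof -
  let ?e = "unit_fun :: nat \<Rightarrow> nat \<Rightarrow> 'a"
  have hU: "h f \<in> coord_space m" if "f \<in> coord_space m" for f using h that unfolding isometry_on_def by blast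
  have "(\<Sum>k<m. h (?e i) k * h (?e j) k) = (if i = j then 1 else 0)" if "i < m" "j < m" for i j
  proof -
    have "dot m (h (?e i)) (h (?e j)) = dot m (?e i) (?e j)"
      using h that unit_fun_in_coord_space unfolding isometry_on_def by blast
    also have "\<dots> = (if i = j then 1 else 0)"
      unfolding dot_unit_fun[OF \<open>j < m\<close>] by (auto simp: unit_fun_def)
    finally show ?thesis by (simp only: dot_def)
  qed
  then have "transpose_mat (mat_of_fun m h) * mat_of_fun m h = 1\<^sub>m m"
    by (intro eq_matI) (auto simp: mat_of_fun_def scalar_prod_def atLeast0LessThan)
  then show "mat_of_fun m h \<in> carrier (orthogonal_group TYPE('a) m)"
    by (simp add: carrier_orthogonal_group mat_of_fun_def)
  assume f: "f \<in> coord_space m"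
  have sum_apply: "(\<Sum>j\<in>J. F j) i = (\<Sum>j\<in>J. F j i)" for F :: "nat \<Rightarrow> nat \<Rightarrow> 'a" and J i
    by (induction J rule: infinite_finite_induct) auto
  have fs: "f = (\<Sum>j<m. fscale (f j) (?e j))"
  proof
    fix i
    show "f i = (\<Sum>j<m. fscale (f j) (?e j)) i"
      using f by (cases "i < m")
        (auto simp: sum_apply fscale_def unit_fun_def coord_space_def if_distrib[of "\<lambda>x. _ * x"] cong: if_cong)
  qed
  have "h f = h (\<Sum>j<m. fscale (f j) (?e j))" by (rule arg_cong[OF fs])
  also have "\<dots> = (\<Sum>j<m. fscale (f j) (h (?e j)))"
    by (rule conjunct1[OF isometry_on_sum_unit_fun[OF h]]) auto
  finally have hf: "h f = (\<Sum>j<m. fscale (f j) (h (?e j)))" .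
  show "mat_act m (mat_of_fun m h) f = h f"
  proof
    fix i
    show "mat_act m (mat_of_fun m h) f i = h f i"
    proof (cases "i < m")
      case True
      then show ?thesis
        unfolding hf by (simp add: mat_act_def mat_of_fun_def sum_apply fscale_def mult.commute)
    next
      case False
      then show ?thesis using f hU[OF f] by (simp add: mat_act_def coord_space_def)
    qed
  qed
qed

lemma conjugate_inverse:
  assumes fin: "finite (coord_space m :: (nat \<Rightarrow> 'a) set)"
    and A: "A \<in> carrier (orthogonal_group TYPE('a) m)"
  shows "\<exists>X\<in>carrier (orthogonal_group TYPE('a) m).
    X \<otimes>\<^bsub>orthogonal_group TYPE('a) m\<^esub> A \<otimes>\<^bsub>orthogonal_group TYPE('a) m\<^esub> inv\<^bsub>orthogonal_group TYPE('a) m\<^esub> X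
      = inv\<^bsub>orthogonal_group TYPE('a) m\<^esub> A"
proof -
  interpret isometry "fscale :: 'a \<Rightarrow> _" "dot m" "mat_act m A" "mat_act m (transpose_mat A)"
    using A by (rule mat_act_isometry)
  note A' = orthogonal_groupD[OF A]
  let ?U = "coord_space m :: (nat \<Rightarrow> 'a) set"
  have "stable ?U" by (simp add: stable_def subspace_coord_space mat_act_in_coord_space)
  then have "reversible ?U" using fin nondegenerate_coord_space[OF two_nz] by (intro reversible_if_nondegenerate)
  then obtain h where h: "isometry_on ?U h" "\<And>u. u \<in> ?U \<Longrightarrow> h (mat_act m A u) = mat_act m (transpose_mat A) (h u)"
    unfolding reversible_def by blast
  define X where "X = mat_of_fun m h"
  have X: "X \<in> carrier (orthogonal_group TYPE('a) m)" unfolding X_def by (rule mat_of_isometry(1)[OF h(1)])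
  note X' = orthogonal_groupD[OF X]
  have act: "mat_act m X u = h u" if "u \<in> ?U" for u unfolding X_def by (rule mat_of_isometry(2)[OF h(1) that])
  have "X * A = transpose_mat A * X"
  proof (rule mat_eq_if_act_eq)
    fix u :: "nat \<Rightarrow> 'a" assume u: "u \<in> ?U"
    show "mat_act m (X * A) u = mat_act m (transpose_mat A * X) u"
      using u X' A' by (simp add: mat_act_mult act mat_act_in_coord_space h(2))
  qed (use X' A' in auto)
  then have "X * A * transpose_mat X = transpose_mat A"
    using X' A' by (simp add: assoc_mult_mat[of _ m m _ m _ m])
  then show ?thesis using X A by (intro bexI[of _ X]) (simp_all add: inv_orthogonal_group)
qed

end

section \<open>The smaller orthogonal group as a stabilizer, and its double cosets\<close>

lemma corner_embedding_image:
  "corner_embedding n ` carrier (orthogonal_group TYPE('a::field) n)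
    = {A \<in> carrier (orthogonal_group TYPE('a) (n + 1)). mat_act (n + 1) A (unit_fun n) = unit_fun n}"
    (is "?L = ?R")
proof (intro equalityI subsetI)
  fix A assume "A \<in> ?L"
  then obtain C where C: "C \<in> carrier_mat n n" "transpose_mat C * C = 1\<^sub>m n" and A: "A = corner_embedding n C"
    by (auto simp: carrier_orthogonal_group)
  have dim: "A \<in> carrier_mat (n + 1) (n + 1)" unfolding A corner_embedding_def
    by (rule four_block_carrier_mat[OF C(1)]) simp
  have entry: "A $$ (i, j) = (if i < n \<and> j < n then C $$ (i, j) else if i = j then 1 else 0)"
    if "i < n + 1" "j < n + 1" for i j
    using that C(1) by (auto simp: A corner_embedding_def)
  have "transpose_mat A * A = 1\<^sub>m (n + 1)"
  proof (rule eq_matI)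
    fix i j assume ij': "i < dim_row (1\<^sub>m (n + 1) :: 'a mat)" "j < dim_col (1\<^sub>m (n + 1) :: 'a mat)"
    then have ij: "i < n + 1" "j < n + 1" by auto
    have "(transpose_mat A * A) $$ (i, j) = (\<Sum>k<n + 1. A $$ (k, i) * A $$ (k, j))"
      using ij dim by (simp add: scalar_prod_def atLeast0LessThan)
    also have "\<dots> = (\<Sum>k<n. A $$ (k, i) * A $$ (k, j)) + A $$ (n, i) * A $$ (n, j)" by simp
    also have "\<dots> = 1\<^sub>m (n + 1) $$ (i, j)"
    proof (cases "i < n \<and> j < n")
      case True
      then have "(\<Sum>k<n. A $$ (k, i) * A $$ (k, j)) = (transpose_mat C * C) $$ (i, j)"
        using C(1) by (simp add: entry scalar_prod_def atLeast0LessThan)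
      then show ?thesis using True by (simp add: entry C(2))
    next
      case False
      then have "(\<Sum>k<n. A $$ (k, i) * A $$ (k, j)) = 0"
        using ij by (intro sum.neutral) (auto simp: entry)
      then show ?thesis using False ij by (auto simp: entry)
    qed
    finally show "(transpose_mat A * A) $$ (i, j) = 1\<^sub>m (n + 1) $$ (i, j)" .
  qed (use dim in auto)
  moreover have "mat_act (n + 1) A (unit_fun n) i = unit_fun n i" for i
  proof (cases "i < n + 1")
    case True
    then show ?thesis by (subst mat_act_unit_fun) (auto simp: entry unit_fun_def)
  qed (simp add: mat_act_def)
  ultimately show "A \<in> ?R" using dim by (auto simp: carrier_orthogonal_group)
next
  fix A assume "A \<in> ?R"
  then have A: "A \<in> carrier (orthogonal_group TYPE('a) (n + 1))"
    and fix_n: "mat_act (n + 1) A (unit_fun n) = unit_fun n" by auto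
  note A' = orthogonal_groupD[OF A]
  \<comment> \<open>The transpose is the inverse and fixes the same vector, so the last row of
    \<open>A\<close>, like its last column, is that of the identity.\<close>
  have "mat_act (n + 1) (transpose_mat A) (unit_fun n) = mat_act (n + 1) (transpose_mat A * A) (unit_fun n)"
    using A'(1,2) by (simp only: mat_act_mult fix_n)
  then have fix_n': "mat_act (n + 1) (transpose_mat A) (unit_fun n) = unit_fun n"
    by (simp only: A'(3) mat_act_one)
  have col: "A $$ (i, n) = (if i = n then 1 else 0)" if "i < n + 1" for i
    using fun_cong[OF fix_n, of i] mat_act_unit_fun[of i "n + 1" n A] that by (simp add: unit_fun_def)
  have row: "A $$ (n, i) = (if i = n then 1 else 0)" if "i < n + 1" for i
    using fun_cong[OF fix_n', of i] mat_act_unit_fun[of i "n + 1" n "transpose_mat A"] that A'(1)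
    by (simp add: unit_fun_def)
  define C where "C = mat n n (\<lambda>(i, j). A $$ (i, j))"
  have "transpose_mat C * C = 1\<^sub>m n"
  proof (rule eq_matI)
    fix i j assume "i < dim_row (1\<^sub>m n :: 'a mat)" "j < dim_col (1\<^sub>m n :: 'a mat)"
    then have ij: "i < n" "j < n" by auto
    have "(\<Sum>k<n + 1. A $$ (k, i) * A $$ (k, j)) = (transpose_mat A * A) $$ (i, j)"
      using ij A'(1) by (simp add: scalar_prod_def atLeast0LessThan)
    then have "(\<Sum>k<n. A $$ (k, i) * A $$ (k, j)) = 1\<^sub>m n $$ (i, j)"
      using ij by (simp add: A'(3) row)
    then show "(transpose_mat C * C) $$ (i, j) = 1\<^sub>m n $$ (i, j)"
      using ij by (simp add: C_def scalar_prod_def atLeast0LessThan)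
  qed (auto simp: C_def)
  then have "C \<in> carrier (orthogonal_group TYPE('a) n)" by (simp add: carrier_orthogonal_group C_def)
  moreover have "A = corner_embedding n C"
  proof (rule eq_matI)
    fix i j assume "i < dim_row (corner_embedding n C)" "j < dim_col (corner_embedding n C)"
    then have "i < n + 1" "j < n + 1" by (auto simp: corner_embedding_def C_def)
    then show "A $$ (i, j) = corner_embedding n C $$ (i, j)"
      using row[of j] col[of i] by (auto simp: corner_embedding_def C_def less_Suc_eq)
  qed (use A'(1) in \<open>auto simp: corner_embedding_def C_def\<close>)
  ultimately show "A \<in> ?L" by blast
qed

lemma subgroup_corner_embedding:
  "subgroup (corner_embedding n ` carrier (orthogonal_group TYPE('a::field) n)) (orthogonal_group TYPE('a) (n + 1))"
proof -
  let ?G = "orthogonal_group TYPE('a) (n + 1)"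
  interpret group ?G by (rule group_orthogonal_group)
  show ?thesis
    unfolding corner_embedding_image
  proof (rule subgroupI)
    show "{A \<in> carrier ?G. mat_act (n + 1) A (unit_fun n) = unit_fun n} \<noteq> {}"
      using one_closed mat_act_one by force
  next
    fix A assume A: "A \<in> {A \<in> carrier ?G. mat_act (n + 1) A (unit_fun n) = unit_fun n}"
    then have A': "A \<in> carrier ?G" "mat_act (n + 1) A (unit_fun n) = unit_fun n" by auto
    note D = orthogonal_groupD[OF A'(1)]
    have "mat_act (n + 1) (transpose_mat A) (unit_fun n) = mat_act (n + 1) (transpose_mat A * A) (unit_fun n)"
      by (simp only: mat_act_mult[OF D(2,1)] A'(2))
    then show "inv\<^bsub>?G\<^esub> A \<in> {A \<in> carrier ?G. mat_act (n + 1) A (unit_fun n) = unit_fun n}"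
      using A'(1) transpose_orthogonal D(3) by (simp add: inv_orthogonal_group mat_act_one)
  next
    fix A C assume "A \<in> {A \<in> carrier ?G. mat_act (n + 1) A (unit_fun n) = unit_fun n}"
      "C \<in> {A \<in> carrier ?G. mat_act (n + 1) A (unit_fun n) = unit_fun n}"
    then show "A \<otimes>\<^bsub>?G\<^esub> C \<in> {A \<in> carrier ?G. mat_act (n + 1) A (unit_fun n) = unit_fun n}"
      using m_closed[of A C] by (simp add: mat_act_mult[OF orthogonal_groupD(1) orthogonal_groupD(1)])
  qed auto
qed

text \<open>With y = A e and z = A^-1 e, Witt's theorem gives X in H with X y = z. Then A X A fixes
  e, and A^-1 = X A (A X A)^-1.\<close>

lemma double_coset_inverse:
  fixes n :: nat
  defines "G \<equiv> orthogonal_group TYPE('a::field) (n + 1)"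
    and "H \<equiv> corner_embedding n ` carrier (orthogonal_group TYPE('a) n)"
  assumes two: "(2::'a) \<noteq> 0" and A: "A \<in> carrier G"
  shows "\<exists>h1\<in>H. \<exists>h2\<in>H. inv\<^bsub>G\<^esub> A = h1 \<otimes>\<^bsub>G\<^esub> A \<otimes>\<^bsub>G\<^esub> h2"
proof -
  interpret G: group G unfolding G_def by (rule group_orthogonal_group)
  interpret H: subgroup H G unfolding G_def H_def by (rule subgroup_corner_embedding)
  interpret bilinear_space "fscale :: 'a \<Rightarrow> _" "dot (n + 1)" using two by (rule bilinear_space_dot)
  note A' = orthogonal_groupD[OF A[unfolded G_def]]
  define act where "act = (mat_act (n + 1) :: 'a mat \<Rightarrow> _)"
  define e where "e = (unit_fun n :: nat \<Rightarrow> 'a)"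
  let ?U = "coord_space (n + 1) :: (nat \<Rightarrow> 'a) set"
  have H_iff: "X \<in> H \<longleftrightarrow> X \<in> carrier G \<and> act X e = e" for X
    unfolding H_def G_def corner_embedding_image act_def e_def by simp
  have mult: "act (X \<otimes>\<^bsub>G\<^esub> Y) f = act X (act Y f)" if "X \<in> carrier G" "Y \<in> carrier G" for X Y f
    using that mat_act_mult[OF orthogonal_groupD(1) orthogonal_groupD(1)] by (simp add: act_def G_def)
  have inv_A: "inv\<^bsub>G\<^esub> A = transpose_mat A" using A unfolding G_def by (rule inv_orthogonal_group)
  have one: "act \<one>\<^bsub>G\<^esub> f = f" for f by (simp only: act_def G_def orthogonal_group_sel mat_act_one)
  have cancel: "act A (act (inv\<^bsub>G\<^esub> A) f) = f" "act (inv\<^bsub>G\<^esub> A) (act A f) = f" for f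
    using A by (simp_all add: mult[symmetric] one del: orthogonal_group_sel)
  define y where "y = act A e"
  define z where "z = act (inv\<^bsub>G\<^esub> A) e"
  have e: "e \<in> ?U" "dot (n + 1) e e = 1"
    by (simp_all add: e_def unit_fun_in_coord_space dot_unit_fun) (simp add: unit_fun_def)
  have adj: "dot (n + 1) (act A f) f' = dot (n + 1) f (act (inv\<^bsub>G\<^esub> A) f')" for f f'
    unfolding act_def inv_A using A'(1) by (rule dot_mat_act)
  have scale: "act X (fscale a f) = fscale a (act X f)" for X a f
    by (auto simp: act_def mat_act_def fscale_def sum_distrib_left distrib_left fun_eq_iff mult.left_commute)
  let ?c = "dot (n + 1) y e"
  have yy: "dot (n + 1) y y = 1" unfolding y_def adj cancel by (rule e(2))
  have "dot (n + 1) z z = dot (n + 1) (act A z) e" unfolding z_def adj ..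
  then have zz: "dot (n + 1) z z = 1" using e(2) by (simp add: z_def cancel)
  have yz: "?c = dot (n + 1) z e" unfolding y_def adj z_def[symmetric] by (rule B_sym)
  have unit: "?c * ?c = 1" if "y = fscale ?c e \<or> z = fscale ?c e"
  proof -
    have "v = fscale ?c e \<Longrightarrow> dot (n + 1) v v = 1 \<Longrightarrow> ?thesis" for v
      using e(2) B_scale B_scale_right by (metis mult.right_neutral)
    then show ?thesis using that yy zz by blast
  qed
  \<comment> \<open>Applying A^-1 to y = c e gives e = c z, where c stands for \<open>?c\<close>,
    and c^2 = 1 because y and e are unit vectors; the converse uses A.\<close>
  have line: "y = fscale ?c e \<longleftrightarrow> z = fscale ?c e"
  proof
    assume y: "y = fscale ?c e"
    have "e = act (inv\<^bsub>G\<^esub> A) y" by (simp add: y_def cancel)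
    also have "\<dots> = fscale ?c z" by (subst y) (simp only: scale z_def)
    finally have "fscale ?c e = fscale ?c (fscale ?c z)" by (rule arg_cong)
    then show "z = fscale ?c e" using unit y by (simp add: fscale_def mult.assoc[symmetric])
  next
    assume z: "z = fscale ?c e"
    have "e = act A z" by (simp add: z_def cancel)
    also have "\<dots> = fscale ?c y" by (subst z) (simp only: scale y_def)
    finally have "fscale ?c e = fscale ?c (fscale ?c y)" by (rule arg_cong)
    then show "y = fscale ?c e" using unit z by (simp add: fscale_def mult.assoc[symmetric])
  qed
  have yU: "y \<in> ?U" and zU: "z \<in> ?U"
    unfolding y_def z_def act_def using e(1) by (auto intro: mat_act_in_coord_space)
  have "moves ?U e y z"
    using subspace_coord_space nondegenerate_coord_space[OF two] e yU zU yy zz yz line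
    by (intro moves_vector) simp_all
  then obtain h where h: "isometry_on ?U h" "h e = e" "h y = z" unfolding moves_def by blast
  define X where "X = mat_of_fun (n + 1) h"
  have X: "X \<in> carrier G" "act X e = e" "act X y = z"
    using mat_of_isometry[OF two h(1)] h(2,3) e(1) yU by (simp_all add: X_def G_def act_def)
  let ?K = "A \<otimes>\<^bsub>G\<^esub> X \<otimes>\<^bsub>G\<^esub> A"
  have "act ?K e = e" using A X by (simp add: mult y_def[symmetric]) (simp add: z_def cancel)
  then have K: "?K \<in> H" using A X(1) by (simp add: H_iff)
  have "X \<otimes>\<^bsub>G\<^esub> A \<otimes>\<^bsub>G\<^esub> inv\<^bsub>G\<^esub> ?K = X \<otimes>\<^bsub>G\<^esub> A \<otimes>\<^bsub>G\<^esub> (inv\<^bsub>G\<^esub> (X \<otimes>\<^bsub>G\<^esub> A) \<otimes>\<^bsub>G\<^esub> inv\<^bsub>G\<^esub> A)"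
    using A X(1) by (simp add: G.inv_mult_group G.m_assoc)
  also have "\<dots> = inv\<^bsub>G\<^esub> A" using A X(1) by (simp add: G.m_assoc[symmetric])
  finally have "inv\<^bsub>G\<^esub> A = X \<otimes>\<^bsub>G\<^esub> A \<otimes>\<^bsub>G\<^esub> inv\<^bsub>G\<^esub> ?K" by (rule sym)
  moreover have "X \<in> H" using X by (simp add: H_iff)
  moreover have "inv\<^bsub>G\<^esub> ?K \<in> H" using K by (rule H.m_inv_closed)
  ultimately show ?thesis by blast
qed

theorem theorem1p6:
  fixes n :: nat
  assumes "\<not> (\<exists>k. card (UNIV :: 'q::{field,finite} set) = 2 ^ k)"
    and "n \<ge> 1"
    and "CHAR('k::alg_closed_field) \<noteq> 2"
  shows "gelfand_pair TYPE('k) TYPE('v::ab_group_add)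
           (orthogonal_group TYPE('q) (n + 1))
           (corner_embedding n ` carrier (orthogonal_group TYPE('q) n))"
proof -
  \<comment> \<open>In characteristic 2 the number of field elements would be a power of 2.\<close>
  have two: "(2::'q) \<noteq> 0" using assms(1) char_2_card_power by blast
  let ?G = "orthogonal_group TYPE('q) (n + 1)"
  let ?H = "corner_embedding n ` carrier (orthogonal_group TYPE('q) n)"
  have "dim_at_most scale (invariants ?H \<pi>) 1" if "irreducible_representation ?G scale \<pi>"
    for scale :: "'k \<Rightarrow> 'v \<Rightarrow> 'v" and \<pi>
  proof -
    have "vector_space scale"
      using that by (simp add: irreducible_representation_def Defs.representation_def)
    then interpret irreducible_rep scale ?G \<pi>
      using that
      by (intro irreducible_rep.intro irreducible_rep_axioms.intro group_orthogonal_group finite_orthogonal_group)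
    show ?thesis
      using conjugate_inverse[OF two finite_coord_space] subgroup_corner_embedding double_coset_inverse[OF two]
      by (intro dim_invariants) blast+
  qed
  then show ?thesis
    using group_orthogonal_group finite_orthogonal_group subgroup_corner_embedding
    by (auto simp: gelfand_pair_def)
qed

end
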